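(* For every ordinal $t\ge\omega$, $G^0(t)=A^0(t)$.
   Context: All variables range over ordinals; $\mathrm{OR}$ is the class of ordinals and each ordinal is identified with the set of smaller ordinals, so for a set $S$ of ordinals and an ordinal $\beta$, $S\subset\beta$ means that all elements of $S$ are $<\beta$. Sums and products are ordinal operations. $\mathrm{Class}(0):=\mathbb{P}=\{\omega^\gamma:\gamma>0\}$ is the class of additive principal ordinals. $\mathrm{Lim}$ is the class of limit ordinals (nonzero), and for a class $A$ of ordinals, $\mathrm{Lim}\,A:=\{\alpha\neq 0:\alpha=\sup(A\cap\alpha)\}$. For $\alpha\le\beta$, $-\alpha+\beta$ is the unique $\sigma$ with $\alpha+\sigma=\beta$. The relation $<_1$. By recursion on $\beta$: $\alpha<_1\beta$ iff $\alpha<\beta$ and for every finite $Z\subset\beta$ there are a finite $\tilde Z\subset\alpha$ and a $(<,<_1,+)$-isomorphism $h:Z\to\tilde Z$ with $h(x)=x$ for all $x\in Z\cap\alpha$. Here a $(<,<_1,+)$-isomorphism $h:Z\to\tilde Z$ between sets of ordinals is a bijection such that for all $a_1,a_2\in Z$: $a_1<a_2\Leftrightarrow h(a_1)<h(a_2)$; $a_1<_1a_2\Leftrightarrow h(a_1)<_1h(a_2)$; $a_1+a_2\in Z\Leftrightarrow h(a_1)+h(a_2)\in\tilde Z$; and if $a_1+a_2\in Z$ then $h(a_1+a_2)=h(a_1)+h(a_2)$. $\alpha\le_1\beta$ means $\alpha<_1\beta$ or $\alpha=\beta$. The maps $g(0,\alpha,c)$. For $\alpha,c\in\mathrm{Class}(0)$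 with $\alpha\le c$, $g(0,\alpha,c):\alpha\omega\to c\omega$ is defined by $g(0,\alpha,c)(x)=x$ if $x<\alpha$, and $g(0,\alpha,c)(\alpha n+l)=cn+l$ for $n\in[1,\omega)$, $l<\alpha$. Moreover $g(0,c,\alpha):=g(0,\alpha,c)^{-1}$, with domain the image of $g(0,\alpha,c)$. The sets $T$. For $\alpha\in\mathrm{Class}(0)$ and $t<\alpha\omega$: $T(0,\alpha,t):=\{t\}$ if $t<\alpha$, and $T(0,\alpha,t):=\{t,-\alpha n+t\}$ if $t\in[\alpha n,\alpha n+\alpha)$ with $n\in[1,\omega)$. The relation $<^0$. For $\alpha\in\mathrm{Class}(0)$ and $t\in[\alpha,\alpha\omega]$, $\alpha<^0t$ means: $\alpha<t$ and for every finite $B\subset t$ there is $\delta\in\mathrm{Class}(0)\cap\alpha$ such that (i) $\left(\bigcup_{q\in B}T(0,\alpha,q)\right)\cap\alpha\subset\delta$, and (ii) the function $h:B\to h[B]$, $h(x):=g(0,\alpha,\delta)(x)$, is a $(<,<_1,+)$-isomorphism with $h(x)=x$ for all $x\in B\cap\alpha$. $\alpha\le^0t$ means $\alpha<^0t$ or $\alpha=t$. The classes $A^0(t)$ and $G^0(t)$. For $t\ge\omega$ let $\alpha\in\mathrm{Class}(0)$ be the unique one with $t\in[\alpha,\alpha\omega)$. By recursion on $t$: - if $t=\alpha$: $A^0(t):=(\mathrm{Lim}\,\mathrm{Class}(0))\cap(\alpha+1)$; - if $t=l+1$: $A^0(t):=\mathrm{Lim}\,A^0(l)$; - if $t\in(\alpha,\alpha\omega)\cap\mathrm{Lim}$: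 $A^0(t):=\mathrm{Lim}\{r\in\mathrm{Class}(0)\cap(\alpha+1): T(0,\alpha,t)\cap\alpha\subset r \text{ and } r\in A^0(s)\text{ for every } s\in(\alpha,t)\text{ with }T(0,\alpha,s)\cap\alpha\subset r\}$. Further, $G^0(t):=\{\beta\in\mathrm{Class}(0): T(0,\alpha,t)\cap\alpha\subset\beta\le\alpha \text{ and } \beta\le^0 g(0,\alpha,\beta)(t)+1\}$. *)

theory Defs
  imports Main
begin

section \<open>Ordinals\<close>

text \<open>
  HOL has no type of all ordinals. The type \<open>'a ordinal\<close> has as its order type the least cardinal
  greater than the cardinalities of \<open>'a\<close> and \<open>nat\<close>. So its elements are the ordinals of cardinality at
  most \<open>max |'a| \<aleph>\<^sub>0\<close>, and every well-order on a subset of \<open>'a\<close> is represented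
  (\<open>ex_ordinal_of_Well_order\<close> below). It is closed under the usual ordinal operations. A statement
  about all \<open>t :: 'a ordinal\<close>, with \<open>'a\<close> a type variable, is therefore a statement about all ordinals
  that exist in HOL. Moreover all the notions below at \<open>t\<close> depend only on
  the ordinals up to the value of \<open>\<alpha> * \<omega>\<close> for the \<open>\<alpha>\<close> associated with \<open>t\<close>, so that restricting \<open>OR\<close> to
  \<open>'a ordinal\<close> does not change them.
\<close>

typedef 'a ordinal = "Field (cardSuc (card_of (UNIV :: ('a + nat) set)))"
proof -
  have "infinite (Field (cardSuc (card_of (UNIV :: ('a + nat) set))))"
    by (simp add: card_of_cardSuc_finite)
  then show ?thesis
    by (metis ex_in_conv finite.emptyI)
qed

abbreviation ordinal_rel :: "'a itself \<Rightarrow> ('a + nat) set rel" where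
  "ordinal_rel _ \<equiv> cardSuc (card_of (UNIV :: ('a + nat) set))"

lemma Card_order_ordinal_rel: "Card_order (ordinal_rel TYPE('a))"
  by (simp add: cardSuc_Card_order card_of_Card_order)

lemma Well_order_ordinal_rel: "Well_order (ordinal_rel TYPE('a))"
  using Card_order_ordinal_rel card_order_on_well_order_on by blast

lemma infinite_Field_ordinal_rel: "infinite (Field (ordinal_rel TYPE('a)))"
  by (simp add: card_of_cardSuc_finite)

instantiation ordinal :: (type) wellorder
begin

definition less_eq_ordinal :: "'a ordinal \<Rightarrow> 'a ordinal \<Rightarrow> bool" where
  "x \<le> y \<longleftrightarrow> (Rep_ordinal x, Rep_ordinal y) \<in> ordinal_rel TYPE('a)"

definition less_ordinal :: "'a ordinal \<Rightarrow> 'a ordinal \<Rightarrow> bool" where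
  "(x :: 'a ordinal) < y \<longleftrightarrow> x \<le> y \<and> x \<noteq> y"

instance
proof
  note W = Well_order_ordinal_rel[where 'a = 'a]
  have lin: "Linear_order (ordinal_rel TYPE('a))" and wf: "wf (ordinal_rel TYPE('a) - Id)"
    using W by (auto simp: well_order_on_def)
  fix x y z :: "'a ordinal"
  show "x \<le> x"
    using lin Rep_ordinal[of x]
    by (auto simp: less_eq_ordinal_def linear_order_on_def partial_order_on_def preorder_on_def refl_on_def)
  show tr: "x \<le> y \<Longrightarrow> y \<le> z \<Longrightarrow> x \<le> z"
    using lin unfolding less_eq_ordinal_def linear_order_on_def partial_order_on_def preorder_on_def
    by (blast dest: transD)
  show asym: "x \<le> y \<Longrightarrow> y \<le> x \<Longrightarrow> x = y"
    using lin unfolding less_eq_ordinal_def linear_order_on_def partial_order_on_def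
    by (metis antisymD Rep_ordinal_inject)
  show "x < y \<longleftrightarrow> x \<le> y \<and> \<not> y \<le> x"
    using lin Rep_ordinal[of x] unfolding less_ordinal_def
    by (metis less_eq_ordinal_def linear_order_on_def partial_order_on_def antisymD Rep_ordinal_inject)
  show "x \<le> y \<or> y \<le> x"
    using lin Rep_ordinal[of x] Rep_ordinal[of y] wo_rel.TOTALS[unfolded wo_rel_def, OF W]
    unfolding less_eq_ordinal_def by blast
  fix P and a :: "'a ordinal"
  assume step: "\<And>x :: 'a ordinal. (\<And>y. y < x \<Longrightarrow> P y) \<Longrightarrow> P x"
  have wf': "wf (inv_image (ordinal_rel TYPE('a) - Id) Rep_ordinal)"
    using wf by (rule wf_inv_image)
  show "P a"
    using wf'
  proof (induction a rule: wf_induct_rule)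
    case (less x)
    show "P x"
    proof (rule step)
      fix y assume "y < x"
      then have "(y, x) \<in> inv_image (ordinal_rel TYPE('a) - Id) Rep_ordinal"
        by (simp add: less_ordinal_def less_eq_ordinal_def Rep_ordinal_inject)
      then show "P y" by (rule less)
    qed
  qed
qed

end

lemma ordinal_bounded:
  fixes A :: "'a ordinal set"
  assumes "(card_of A, card_of (UNIV :: ('a + nat) set)) \<in> ordLeq"
  shows "\<exists>c. \<forall>x\<in>A. x < c"
proof -
  let ?r = "ordinal_rel TYPE('a)"
  have reg: "regularCard ?r"
    by (rule infinite_cardSuc_regularCard[OF _ card_of_Card_order]) (simp add: Field_card_of)
  have sub: "Rep_ordinal ` A \<subseteq> Field ?r"
    using Rep_ordinal by auto
  have "(card_of (Rep_ordinal ` A), card_of (UNIV :: ('a + nat) set)) \<in> ordLeq"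
    by (rule ordLeq_transitive[OF card_of_image assms])
  then have "(card_of (Rep_ordinal ` A), ?r) \<in> ordLess"
    by (rule ordLeq_ordLess_trans[OF _ cardSuc_greater[OF card_of_Card_order]])
  then have "\<not> cofinal (Rep_ordinal ` A) ?r"
    using reg sub not_ordLess_ordIso unfolding regularCard_def by blast
  then obtain a where a: "a \<in> Field ?r" "\<forall>b\<in>Rep_ordinal ` A. \<not> (a \<noteq> b \<and> (a, b) \<in> ?r)"
    unfolding cofinal_def by blast
  obtain b where b: "b \<in> Field ?r" "a \<noteq> b" "(a, b) \<in> ?r"
    using infinite_Card_order_limit[OF Card_order_ordinal_rel infinite_Field_ordinal_rel a(1)] by blast
  have "x < Abs_ordinal b" if "x \<in> A" for x
  proof -
    have "x \<le> Abs_ordinal a"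
    proof (rule ccontr)
      assume "\<not> x \<le> Abs_ordinal a"
      then have less: "Abs_ordinal a < x" by simp
      then have "a \<noteq> Rep_ordinal x" by (metis Rep_ordinal_inverse less_irrefl)
      moreover have "(a, Rep_ordinal x) \<in> ?r"
        using less a(1) by (simp add: less_ordinal_def less_eq_ordinal_def Abs_ordinal_inverse)
      ultimately show False
        using a(2) that by blast
    qed
    moreover have "Abs_ordinal a < Abs_ordinal b"
      using a(1) b by (simp add: less_ordinal_def less_eq_ordinal_def Abs_ordinal_inverse Abs_ordinal_inject)
    ultimately show ?thesis by simp
  qed
  then show ?thesis by blast
qed

lemma card_of_lessThan_ordinal:
  fixes x :: "'a ordinal"
  shows "(card_of {..<x}, card_of (UNIV :: ('a + nat) set)) \<in> ordLeq"
proof -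
  let ?r = "ordinal_rel TYPE('a)"
  have "Rep_ordinal ` {..<x} \<subseteq> underS ?r (Rep_ordinal x)"
    by (auto simp: underS_def less_ordinal_def less_eq_ordinal_def Rep_ordinal_inject)
  then have "(card_of {..<x}, card_of (underS ?r (Rep_ordinal x))) \<in> ordLeq"
    by (meson card_of_ordLeq inj_on_def Rep_ordinal_inject)
  moreover have "(card_of (underS ?r (Rep_ordinal x)), ?r) \<in> ordLess"
    by (rule card_of_underS[OF Card_order_ordinal_rel Rep_ordinal])
  ultimately have "(card_of {..<x}, ?r) \<in> ordLess"
    using ordLeq_ordLess_trans by blast
  then show ?thesis
    by (simp add: cardSuc_ordLeq_ordLess card_of_Card_order)
qed

lemma ordinal_image_bounded:
  fixes f :: "'a ordinal \<Rightarrow> 'a ordinal"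
  shows "\<exists>c. \<forall>x<b. f x < c"
proof -
  have "(card_of (f ` {..<b}), card_of (UNIV :: ('a + nat) set)) \<in> ordLeq"
    using card_of_image card_of_lessThan_ordinal ordLeq_transitive by blast
  from ordinal_bounded[OF this] show ?thesis by auto
qed

lemma ordinal_gt_ex: "\<exists>y. (x :: 'a ordinal) < y"
proof -
  have "(card_of {x}, card_of (UNIV :: ('a + nat) set)) \<in> ordLeq"
    by (meson card_of_singl_ordLeq UNIV_not_empty)
  from ordinal_bounded[OF this] show ?thesis by auto
qed


lemma ex_ordinal_of_Well_order:
  fixes r :: "'a rel"
  assumes "Well_order r"
  shows "\<exists>(x :: 'a ordinal) f. bij_betw f (Field r) {..<x} \<and>
    (\<forall>a\<in>Field r. \<forall>b\<in>Field r. (a, b) \<in> r \<longleftrightarrow> f a \<le> f b)"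
proof -
  let ?R = "ordinal_rel TYPE('a)"
  have "(card_of (Field r), card_of (UNIV :: ('a + nat) set)) \<in> ordLeq"
    by (rule card_of_ordLeqI[of Inl]) auto
  then have lt: "(card_of (Field r), ?R) \<in> ordLess"
    by (simp add: cardSuc_ordLeq_ordLess card_of_Card_order)
  have "(r, ?R) \<in> ordLess"
  proof (rule ccontr)
    assume "(r, ?R) \<notin> ordLess"
    then have "(?R, r) \<in> ordLeq"
      using assms Well_order_ordinal_rel not_ordLess_iff_ordLeq by blast
    then have "(card_of (Field ?R), card_of (Field r)) \<in> ordLeq"
      by (rule card_of_mono2)
    then have "(?R, card_of (Field r)) \<in> ordLeq"
      using card_of_Field_ordIso[OF Card_order_ordinal_rel] ordIso_ordLeq_trans ordIso_symmetric by blast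
    then show False
      using lt not_ordLess_ordLeq by blast
  qed
  then obtain a where a: "a \<in> Field ?R" "(r, Restr ?R (underS ?R a)) \<in> ordIso"
    using ordLess_iff_ordIso_Restr[OF Well_order_ordinal_rel assms] by blast
  then obtain f where "iso r (Restr ?R (underS ?R a)) f"
    unfolding ordIso_def by blast
  then have f: "bij_betw f (Field r) (Field (Restr ?R (underS ?R a)))"
    "\<forall>x\<in>Field r. \<forall>y\<in>Field r. (x, y) \<in> r \<longleftrightarrow> (f x, f y) \<in> Restr ?R (underS ?R a)"
    using assms by (auto simp: iso_iff2)
  have "wo_rel.ofilter ?R (underS ?R a)"
    by (rule wo_rel.underS_ofilter) (simp only: wo_rel_def Well_order_ordinal_rel)
  then have F: "Field (Restr ?R (underS ?R a)) = underS ?R a"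
    using Well_order_ordinal_rel Field_Restr_ofilter by blast
  have sub: "underS ?R a \<subseteq> Field ?R"
    by (auto simp: underS_def Field_def)
  have "bij_betw Abs_ordinal (underS ?R a) {..<Abs_ordinal a}"
  proof (rule bij_betwI')
    fix x y assume "x \<in> underS ?R a" "y \<in> underS ?R a"
    then show "(Abs_ordinal x = Abs_ordinal y) = (x = y)"
      using sub by (simp add: Abs_ordinal_inject subset_iff)
  next
    fix x assume x: "x \<in> underS ?R a"
    then have "x \<in> Field ?R"
      using sub by blast
    then show "Abs_ordinal x \<in> {..<Abs_ordinal a}"
      using x a(1)
      by (simp add: less_ordinal_def less_eq_ordinal_def Abs_ordinal_inverse Abs_ordinal_inject underS_def)
  next
    fix y assume "y \<in> {..<Abs_ordinal a}"
    then have "Rep_ordinal y \<in> underS ?R a" "y = Abs_ordinal (Rep_ordinal y)"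
      using a(1) by (auto simp: less_ordinal_def less_eq_ordinal_def underS_def Abs_ordinal_inverse Rep_ordinal_inverse)
    then show "\<exists>x\<in>underS ?R a. y = Abs_ordinal x" by blast
  qed
  then have "bij_betw (Abs_ordinal \<circ> f) (Field r) {..<Abs_ordinal a}"
    using f(1) F bij_betw_trans by metis
  moreover have "(x, y) \<in> r \<longleftrightarrow> (Abs_ordinal \<circ> f) x \<le> (Abs_ordinal \<circ> f) y"
    if "x \<in> Field r" "y \<in> Field r" for x y
  proof -
    have "f x \<in> underS ?R a" "f y \<in> underS ?R a"
      using that f(1) F by (auto simp: bij_betw_def)
    moreover from this have "f x \<in> Field ?R" "f y \<in> Field ?R"
      using sub by auto
    ultimately show ?thesis
      using f(2) that by (simp add: less_eq_ordinal_def Abs_ordinal_inverse)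
  qed
  ultimately show ?thesis by blast
qed

text \<open>Here \<open>Sup\<close> of a bounded set is its supremum, and \<open>Sup {} = 0\<close>.\<close>

instantiation ordinal :: (type) conditionally_complete_linorder
begin

definition inf_ordinal :: "'a ordinal \<Rightarrow> 'a ordinal \<Rightarrow> 'a ordinal" where
  "inf_ordinal = min"

definition sup_ordinal :: "'a ordinal \<Rightarrow> 'a ordinal \<Rightarrow> 'a ordinal" where
  "sup_ordinal = max"

definition Inf_ordinal :: "'a ordinal set \<Rightarrow> 'a ordinal" where
  "Inf (X :: 'a ordinal set) = (LEAST x. x \<in> X)"

definition Sup_ordinal :: "'a ordinal set \<Rightarrow> 'a ordinal" where
  "Sup (X :: 'a ordinal set) = (LEAST u. \<forall>x\<in>X. x \<le> u)"

instance
proof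
  fix x y z :: "'a ordinal" and X :: "'a ordinal set"
  show "inf x y \<le> x" "inf x y \<le> y" "x \<le> sup x y" "y \<le> sup x y"
    "x \<le> y \<Longrightarrow> x \<le> z \<Longrightarrow> x \<le> inf y z" "y \<le> x \<Longrightarrow> z \<le> x \<Longrightarrow> sup y z \<le> x"
    by (auto simp: inf_ordinal_def sup_ordinal_def)
  show "Inf X \<le> x" if "x \<in> X" "bdd_below X"
    unfolding Inf_ordinal_def using that(1) by (rule Least_le)
  show "z \<le> Inf X" if ne: "X \<noteq> {}" and lb: "\<And>x. x \<in> X \<Longrightarrow> z \<le> x"
  proof (rule lb)
    obtain k where "k \<in> X" using ne by blast
    then show "Inf X \<in> X" unfolding Inf_ordinal_def by (rule LeastI)
  qed
  show "x \<le> Sup X" if x: "x \<in> X" and bdd: "bdd_above X"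
  proof -
    obtain u where "\<forall>x\<in>X. x \<le> u" using bdd unfolding bdd_above_def by blast
    then have "\<forall>x\<in>X. x \<le> Sup X" unfolding Sup_ordinal_def by (rule LeastI)
    then show ?thesis using x by blast
  qed
  show "Sup X \<le> z" if "X \<noteq> {}" "\<And>x. x \<in> X \<Longrightarrow> x \<le> z"
    unfolding Sup_ordinal_def by (rule Least_le) (use that(2) in blast)
qed

end


section \<open>Ordinal arithmetic\<close>

instantiation ordinal :: (type) "{zero, one, plus, times}"
begin

definition zero_ordinal :: "'a ordinal" where
  "0 = (LEAST x :: 'a ordinal. True)"

definition one_ordinal :: "'a ordinal" where
  "1 = (LEAST x :: 'a ordinal. 0 < x)"

text \<open>The usual clauses for zero, successors and limits are derived below.\<close>

function plus_ordinal :: "'a ordinal \<Rightarrow> 'a ordinal \<Rightarrow> 'a ordinal" where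
  "plus_ordinal a b = (LEAST c. a \<le> c \<and> (\<forall>b'<b. plus_ordinal a b' < c))"
  by auto
termination by (relation "inv_image {(x, y). x < y} snd") (rule wf_inv_image[OF wf], auto)

declare plus_ordinal.simps [simp del]

function times_ordinal :: "'a ordinal \<Rightarrow> 'a ordinal \<Rightarrow> 'a ordinal" where
  "times_ordinal a b = (LEAST c. \<forall>b'<b. times_ordinal a b' + a \<le> c)"
  by auto
termination by (relation "inv_image {(x, y). x < y} snd") (rule wf_inv_image[OF wf], auto)

instance ..

end

declare times_ordinal.simps [simp del]

definition LimOrd :: "'a ordinal set" where
  "LimOrd = {l. l \<noteq> 0 \<and> (\<nexists>k. l = k + 1)}"

definition omega :: "'a ordinal" (\<open>\<omega>\<close>) where
  "\<omega> = (LEAST l. l \<in> LimOrd)"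

function omega_pow :: "'a ordinal \<Rightarrow> 'a ordinal" where
  "omega_pow b = (LEAST c. 1 \<le> c \<and> (\<forall>b'<b. omega_pow b' * \<omega> \<le> c))"
  by auto
termination by (relation "{(x, y). x < y}") (rule wf, auto)

declare omega_pow.simps [simp del]

lemma ordinal_zero_le [simp]: "0 \<le> (x :: 'a ordinal)"
  unfolding zero_ordinal_def by (rule Least_le) simp

lemma ordinal_not_less_zero [simp]: "\<not> x < (0 :: 'a ordinal)"
  by (simp add: not_less)

lemma ordinal_zero_less_one [simp]: "0 < (1 :: 'a ordinal)"
  unfolding one_ordinal_def by (rule LeastI_ex) (rule ordinal_gt_ex)

lemma plus_ordinal_props:
  fixes a b :: "'a ordinal"
  shows le_plus_ordinal: "a \<le> a + b"
    and plus_ordinal_strict_mono: "b' < b \<Longrightarrow> a + b' < a + b"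
    and plus_ordinal_least: "a \<le> c \<Longrightarrow> (\<And>b'. b' < b \<Longrightarrow> a + b' < c) \<Longrightarrow> a + b \<le> c"
proof -
  obtain c where c: "\<forall>x<b. a + x < c"
    using ordinal_image_bounded[of b "\<lambda>x. a + x"] by blast
  have "a \<le> max a c \<and> (\<forall>b'<b. a + b' < max a c)"
    using c by (simp add: less_max_iff_disj)
  then have "a \<le> a + b \<and> (\<forall>b'<b. a + b' < a + b)"
    unfolding plus_ordinal.simps[of a b] by (rule LeastI)
  then show "a \<le> a + b" "b' < b \<Longrightarrow> a + b' < a + b"
    by auto
  show "a \<le> c \<Longrightarrow> (\<And>b'. b' < b \<Longrightarrow> a + b' < c) \<Longrightarrow> a + b \<le> c" for c
    unfolding plus_ordinal.simps[of a b] by (rule Least_le) auto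
qed

lemma ordinal_less_one_iff [simp]: "x < 1 \<longleftrightarrow> x = (0 :: 'a ordinal)"
proof
  assume "x < 1"
  then have "\<not> 0 < x"
    unfolding one_ordinal_def by (rule not_less_Least)
  then show "x = 0"
    by (simp only: not_less ordinal_zero_le order_antisym)
qed simp

lemma plus_ordinal_zero [simp]: "a + 0 = (a :: 'a ordinal)"
  by (intro antisym plus_ordinal_least le_plus_ordinal) auto

lemma ordinal_less_add_one [simp]: "a < a + (1 :: 'a ordinal)"
  using plus_ordinal_strict_mono[of 0 1 a] by simp

lemma ordinal_add_one_le_iff [simp]: "a + 1 \<le> b \<longleftrightarrow> a < (b :: 'a ordinal)"
proof
  show "a < b" if "a + 1 \<le> b"
    using that ordinal_less_add_one by (rule less_le_trans[rotated])
  show "a + 1 \<le> b" if "a < b"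
    using that by (intro plus_ordinal_least) auto
qed

lemma ordinal_less_add_one_iff: "b < a + 1 \<longleftrightarrow> b \<le> (a :: 'a ordinal)"
  using ordinal_add_one_le_iff[of a b] not_le[of "a + 1" b] not_less[of a b] by blast

lemma ordinal_add_one_inject: "a + 1 = b + 1 \<longleftrightarrow> a = (b :: 'a ordinal)"
proof
  assume eq: "a + 1 = b + 1"
  have "a < b + 1" "b < a + 1"
    using ordinal_less_add_one[of a] ordinal_less_add_one[of b] by (simp_all only: eq)
  then show "a = b"
    by (simp only: ordinal_less_add_one_iff order_antisym)
qed simp

lemma plus_ordinal_succ: "a + (b + 1) = (a + b) + (1 :: 'a ordinal)"
proof (rule antisym)
  show "a + (b + 1) \<le> (a + b) + 1"
  proof (rule plus_ordinal_least)
    show "a \<le> a + b + 1"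
      using le_plus_ordinal[of a b] ordinal_less_add_one[of "a + b"] by (meson order_trans less_imp_le)
    fix b' assume "b' < b + 1"
    then have "a + b' \<le> a + b"
      by (metis ordinal_less_add_one_iff order_le_less plus_ordinal_strict_mono)
    then show "a + b' < a + b + 1"
      by (simp only: ordinal_less_add_one_iff)
  qed
  show "(a + b) + 1 \<le> a + (b + 1)"
    by (simp add: plus_ordinal_strict_mono)
qed

lemma LimOrd_add_one_less:
  assumes "l \<in> LimOrd" "b < l"
  shows "b + 1 < l"
proof -
  have "b + 1 \<le> l" using assms by simp
  moreover have "b + 1 \<noteq> l" using assms unfolding LimOrd_def by blast
  ultimately show ?thesis by (rule order_le_neq_trans)
qed

lemma LimOrd_pos: "l \<in> LimOrd \<Longrightarrow> 0 < l"
  unfolding LimOrd_def by (simp add: order_less_le)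

lemma plus_ordinal_LimOrd:
  assumes "l \<in> LimOrd"
  shows "a + l = (SUP b\<in>{..<l}. a + b)"
proof (rule antisym)
  have bdd: "bdd_above ((+) a ` {..<l})"
    by (rule bdd_aboveI[of _ "a + l"]) (auto intro: less_imp_le plus_ordinal_strict_mono)
  have ne: "{..<l} \<noteq> {}"
    using LimOrd_pos[OF assms] by blast
  show "(SUP b\<in>{..<l}. a + b) \<le> a + l"
    using ne by (intro cSUP_least) (auto intro: less_imp_le plus_ordinal_strict_mono)
  show "a + l \<le> (SUP b\<in>{..<l}. a + b)"
  proof (rule plus_ordinal_least)
    show "a \<le> (SUP b\<in>{..<l}. a + b)"
      using cSUP_upper[of 0 _ "(+) a", OF _ bdd] LimOrd_pos[OF assms] by simp
    fix b assume "b < l"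
    then have "a + (b + 1) \<le> (SUP b\<in>{..<l}. a + b)"
      using LimOrd_add_one_less[OF assms] by (intro cSUP_upper[of _ _ "(+) a", OF _ bdd]) simp
    then show "a + b < (SUP b\<in>{..<l}. a + b)"
      by (simp add: plus_ordinal_succ)
  qed
qed

lemma times_ordinal_props:
  fixes a b :: "'a ordinal"
  shows times_ordinal_add_le: "b' < b \<Longrightarrow> a * b' + a \<le> a * b"
    and times_ordinal_least: "(\<And>b'. b' < b \<Longrightarrow> a * b' + a \<le> c) \<Longrightarrow> a * b \<le> c"
proof -
  obtain c where c: "\<forall>x<b. a * x + a < c"
    using ordinal_image_bounded[of b "\<lambda>x. a * x + a"] by blast
  have "\<forall>b'<b. a * b' + a \<le> c"
  proof (intro allI impI)
    show "a * b' + a \<le> c" if "b' < b" for b'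
      using c that by (intro less_imp_le) blast
  qed
  then have "\<forall>b'<b. a * b' + a \<le> a * b"
    unfolding times_ordinal.simps[of a b] by (rule LeastI)
  then show "b' < b \<Longrightarrow> a * b' + a \<le> a * b"
    by blast
  show "(\<And>b'. b' < b \<Longrightarrow> a * b' + a \<le> c) \<Longrightarrow> a * b \<le> c" for c
    unfolding times_ordinal.simps[of a b] by (rule Least_le) blast
qed

lemma times_ordinal_mono:
  assumes "b \<le> b'"
  shows "a * b \<le> a * (b' :: 'a ordinal)"
proof (cases "b = b'")
  case False
  with assms have "b < b'" by simp
  then show ?thesis
    by (rule order_trans[OF le_plus_ordinal times_ordinal_add_le])
qed simp

lemma plus_ordinal_mono_left: "a \<le> b \<Longrightarrow> a + c \<le> b + (c :: 'a ordinal)"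
proof (induction c rule: less_induct)
  case (less c)
  show ?case
  proof (rule plus_ordinal_least)
    show "a \<le> b + c"
      using less.prems le_plus_ordinal by (rule order_trans)
    show "a + d < b + c" if "d < c" for d
      using less.IH[OF that less.prems] plus_ordinal_strict_mono[OF that] by (rule order_le_less_trans)
  qed
qed

lemma times_ordinal_zero [simp]: "a * 0 = (0 :: 'a ordinal)"
  by (intro antisym times_ordinal_least) auto

lemma times_ordinal_succ: "a * (b + 1) = a * b + (a :: 'a ordinal)"
proof (rule antisym)
  show "a * (b + 1) \<le> a * b + a"
    by (rule times_ordinal_least) (simp only: ordinal_less_add_one_iff plus_ordinal_mono_left times_ordinal_mono)
  show "a * b + a \<le> a * (b + 1)"
    by (rule times_ordinal_add_le) simp
qed

lemma times_ordinal_LimOrd: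
  assumes "l \<in> LimOrd"
  shows "a * l = (SUP b\<in>{..<l}. a * b)"
proof (rule antisym)
  have bdd: "bdd_above ((*) a ` {..<l})"
    by (rule bdd_aboveI[of _ "a * l"]) (auto intro: less_imp_le times_ordinal_mono)
  have ne: "{..<l} \<noteq> {}"
    using LimOrd_pos[OF assms] by blast
  show "(SUP b\<in>{..<l}. a * b) \<le> a * l"
    using ne by (intro cSUP_least) (auto intro: less_imp_le times_ordinal_mono)
  show "a * l \<le> (SUP b\<in>{..<l}. a * b)"
  proof (rule times_ordinal_least)
    fix b assume "b < l"
    then have "a * (b + 1) \<le> (SUP b\<in>{..<l}. a * b)"
      using LimOrd_add_one_less[OF assms] by (intro cSUP_upper[of _ _ "(*) a", OF _ bdd]) simp
    then show "a * b + a \<le> (SUP b\<in>{..<l}. a * b)"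
      by (simp add: times_ordinal_succ)
  qed
qed

lemma ex_LimOrd: "\<exists>l :: 'a ordinal. l \<in> LimOrd"
proof -
  define f where "f n = ((\<lambda>x :: 'a ordinal. x + 1) ^^ n) 0" for n
  have "(card_of (range f), card_of (UNIV :: ('a + nat) set)) \<in> ordLeq"
    by (rule ordLeq_transitive[OF card_of_image card_of_ordLeqI[of Inr]]) auto
  then obtain c where "\<forall>x\<in>range f. x < c"
    using ordinal_bounded by blast
  then have ub: "\<exists>c. \<forall>n. f n < c"
    by auto
  define l where "l = (LEAST c. \<forall>n. f n < c)"
  have l: "\<forall>n. f n < l"
    unfolding l_def using ub by (rule LeastI_ex)
  have "l \<noteq> k + 1" for k
  proof
    assume k: "l = k + 1"
    then have "k < l"
      by simp
    then have "\<not> (\<forall>n. f n < k)"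
      unfolding l_def by (rule not_less_Least)
    then obtain n where "k \<le> f n"
      by (auto simp: not_less)
    then have "l \<le> f (Suc n)"
      by (simp add: k f_def ordinal_less_add_one_iff)
    then show False
      using l by (simp add: not_less[symmetric])
  qed
  moreover have "l \<noteq> 0"
    using l by auto
  ultimately show ?thesis
    by (auto simp: LimOrd_def)
qed

lemma omega_in_LimOrd: "\<omega> \<in> LimOrd"
  unfolding omega_def using ex_LimOrd by (rule LeastI_ex)

lemma omega_pow_props:
  fixes b :: "'a ordinal"
  shows one_le_omega_pow: "1 \<le> omega_pow b"
    and omega_pow_times_le: "b' < b \<Longrightarrow> omega_pow b' * \<omega> \<le> omega_pow b"
    and omega_pow_least: "1 \<le> c \<Longrightarrow> (\<And>b'. b' < b \<Longrightarrow> omega_pow b' * \<omega> \<le> c) \<Longrightarrow> omega_pow b \<le> c"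
proof -
  obtain c where c: "\<forall>x<b. omega_pow x * \<omega> < c"
    using ordinal_image_bounded[of b "\<lambda>x. omega_pow x * \<omega>"] by blast
  have "omega_pow b' * \<omega> \<le> max 1 c" if "b' < b" for b'
    using c that by (intro max.coboundedI2 less_imp_le) blast
  then have "1 \<le> max 1 c \<and> (\<forall>b'<b. omega_pow b' * \<omega> \<le> max 1 c)"
    using max.cobounded1 by blast
  then have "1 \<le> omega_pow b \<and> (\<forall>b'<b. omega_pow b' * \<omega> \<le> omega_pow b)"
    unfolding omega_pow.simps[of b] by (rule LeastI)
  then show "1 \<le> omega_pow b" "b' < b \<Longrightarrow> omega_pow b' * \<omega> \<le> omega_pow b"
    by blast+
  show "1 \<le> c \<Longrightarrow> (\<And>b'. b' < b \<Longrightarrow> omega_pow b' * \<omega> \<le> c) \<Longrightarrow> omega_pow b \<le> c" for c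
    unfolding omega_pow.simps[of b] by (rule Least_le) blast
qed

lemma omega_pow_zero: "omega_pow 0 = 1"
  by (intro antisym omega_pow_least one_le_omega_pow) auto

lemma times_ordinal_mono_left: "a \<le> b \<Longrightarrow> a * c \<le> b * (c :: 'a ordinal)"
proof (induction c rule: less_induct)
  case (less c)
  have "a * d + a \<le> b * c" if "d < c" for d
  proof -
    have "a * d + a \<le> b * d + a"
      using less that by (intro plus_ordinal_mono_left) auto
    also have "\<dots> \<le> b * d + b"
      using less.prems by (metis order_le_less plus_ordinal_strict_mono order_refl)
    also have "\<dots> \<le> b * c"
      using that by (rule times_ordinal_add_le)
    finally show ?thesis .
  qed
  then show ?case
    by (rule times_ordinal_least)
qed

lemma zero_plus_ordinal [simp]: "0 + a = (a :: 'a ordinal)"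
proof (induction a rule: less_induct)
  case (less a)
  show ?case
  proof (rule antisym)
    show "0 + a \<le> a"
      using less by (intro plus_ordinal_least) auto
    show "a \<le> 0 + a"
      using less plus_ordinal_strict_mono[of _ a 0] by (metis less_irrefl not_le)
  qed
qed

lemma times_ordinal_one [simp]: "a * 1 = (a :: 'a ordinal)"
  using times_ordinal_succ[of a 0] by simp

lemma one_less_omega: "1 < (\<omega> :: 'a ordinal)"
  using LimOrd_add_one_less[OF omega_in_LimOrd LimOrd_pos[OF omega_in_LimOrd]] by simp

lemma omega_pow_mono: "b \<le> b' \<Longrightarrow> omega_pow b \<le> omega_pow b'"
  by (metis less_imp_le one_less_omega omega_pow_times_le order_le_less order_trans times_ordinal_mono
      times_ordinal_one)

lemma omega_pow_succ: "omega_pow (b + 1) = omega_pow b * \<omega>"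
proof (rule antisym)
  have "1 \<le> omega_pow b * \<omega>"
    using one_le_omega_pow[of b] times_ordinal_mono[OF less_imp_le[OF one_less_omega], of "omega_pow b"]
    by simp
  then show "omega_pow (b + 1) \<le> omega_pow b * \<omega>"
    by (rule omega_pow_least)
      (auto simp: ordinal_less_add_one_iff intro!: times_ordinal_mono_left omega_pow_mono)
qed (simp add: omega_pow_times_le)

lemma omega_pow_LimOrd:
  assumes "l \<in> LimOrd"
  shows "omega_pow l = (SUP b\<in>{..<l}. omega_pow b)"
proof (rule antisym)
  have bdd: "bdd_above (omega_pow ` {..<l})"
    by (rule bdd_aboveI[of _ "omega_pow l"]) (auto intro: less_imp_le omega_pow_mono)
  have ne: "{..<l} \<noteq> {}"
    using LimOrd_pos[OF assms] by blast
  show "(SUP b\<in>{..<l}. omega_pow b) \<le> omega_pow l"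
    using ne by (intro cSUP_least) (auto intro: less_imp_le omega_pow_mono)
  show "omega_pow l \<le> (SUP b\<in>{..<l}. omega_pow b)"
  proof (rule omega_pow_least)
    show "1 \<le> (SUP b\<in>{..<l}. omega_pow b)"
      using cSUP_upper[of 0 _ omega_pow, OF _ bdd] LimOrd_pos[OF assms] by (simp add: omega_pow_zero)
    fix b assume "b < l"
    then have "omega_pow (b + 1) \<le> (SUP b\<in>{..<l}. omega_pow b)"
      using LimOrd_add_one_less[OF assms] by (intro cSUP_upper[of _ _ "omega_pow", OF _ bdd]) simp
    then show "omega_pow b * \<omega> \<le> (SUP b\<in>{..<l}. omega_pow b)"
      by (simp add: omega_pow_succ)
  qed
qed

text \<open>For \<open>a \<le> b\<close>, this is the unique \<open>s\<close> with \<open>a + s = b\<close>.\<close>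

definition left_diff :: "'a ordinal \<Rightarrow> 'a ordinal \<Rightarrow> 'a ordinal" where
  "left_diff a b = (THE s. a + s = b)"

lemma plus_ordinal_left_cancel: "a + b = a + c \<longleftrightarrow> b = (c :: 'a ordinal)"
  by (metis less_irrefl linorder_neqE plus_ordinal_strict_mono)

lemma le_plus_ordinal_right: "b \<le> a + (b :: 'a ordinal)"
  using plus_ordinal_mono_left[of 0 a b] by simp

lemma plus_left_diff:
  fixes a b :: "'a ordinal"
  assumes "a \<le> b"
  shows "a + left_diff a b = b"
proof -
  define s where "s = (LEAST s. b \<le> a + s)"
  have s: "b \<le> a + s"
    unfolding s_def by (rule LeastI) (rule le_plus_ordinal_right)
  have "a + s \<le> b"
    using assms by (rule plus_ordinal_least) (metis not_le not_less_Least s_def)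
  with s have "a + s = b"
    by simp
  then show ?thesis
    unfolding left_diff_def by (rule theI) (metis plus_ordinal_left_cancel \<open>a + s = b\<close>)
qed


section \<open>Additive principal ordinals\<close>

definition Class0 :: "'a ordinal set" where
  "Class0 = {omega_pow \<gamma> | \<gamma>. 0 < \<gamma>}"

definition LimOf :: "'a ordinal set \<Rightarrow> 'a ordinal set" where
  "LimOf A = {\<alpha>. \<alpha> \<noteq> 0 \<and> \<alpha> = Sup (A \<inter> {..<\<alpha>})}"

text \<open>The \<open>\<alpha> \<in> Class0\<close> with \<open>t \<in> [\<alpha>, \<alpha> * \<omega>)\<close>, for \<open>t \<ge> \<omega>\<close>.\<close>

definition principal_part :: "'a ordinal \<Rightarrow> 'a ordinal" where
  "principal_part t = (THE \<alpha>. \<alpha> \<in> Class0 \<and> t \<in> {\<alpha>..<\<alpha> * \<omega>})"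

lemma ex1_principal_part:
  fixes t :: "'a ordinal"
  assumes "\<omega> \<le> t"
  shows "\<exists>!\<alpha>. \<alpha> \<in> Class0 \<and> t \<in> {\<alpha>..<\<alpha> * \<omega>}"
proof -
  have less: "omega_pow b < omega_pow (b + 1)" for b :: "'a ordinal"
  proof -
    have "omega_pow b + 0 < omega_pow b + omega_pow b"
      by (rule plus_ordinal_strict_mono) (meson one_le_omega_pow order_less_le_trans ordinal_zero_less_one)
    also have "\<dots> = omega_pow b * (1 + 1)"
      using times_ordinal_succ[of "omega_pow b" 1] by simp
    also have "\<dots> \<le> omega_pow (b + 1)"
      unfolding omega_pow_succ
      by (rule times_ordinal_mono) (simp add: one_less_omega)
    finally show ?thesis by simp
  qed
  have le: "b \<le> omega_pow b" for b :: "'a ordinal"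
  proof (induction b rule: less_induct)
    case (less b)
    have "x < omega_pow b" if "x < b" for x
    proof -
      have "x \<le> omega_pow x" using less that by blast
      also have "\<dots> < omega_pow (x + 1)" by (rule \<open>\<And>b. omega_pow b < omega_pow (b + 1)\<close>)
      also have "\<dots> \<le> omega_pow b" using that by (intro omega_pow_mono) simp
      finally show ?thesis .
    qed
    then show ?case by (meson less_irrefl not_le)
  qed
  define d where "d = (LEAST d. t < omega_pow d)"
  have ex: "t < omega_pow (t + 1)"
    using le[of "t + 1"] by simp
  have d: "t < omega_pow d"
    unfolding d_def using ex by (rule LeastI)
  have d_least: "omega_pow e \<le> t" if "e < d" for e
    using not_less_Least[of e] that unfolding d_def by (metis not_le)
  have om: "omega_pow 1 = (\<omega> :: 'a ordinal)"
  proof -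
    have "1 * a = a" for a :: "'a ordinal"
    proof (induction a rule: less_induct)
      case (less a)
      show ?case
      proof (rule antisym)
        show "1 * a \<le> a"
          using less by (intro times_ordinal_least) simp
        show "a \<le> 1 * a"
          using less times_ordinal_add_le[of _ a 1] by (metis less_irrefl not_le ordinal_add_one_le_iff)
      qed
    qed
    then show ?thesis
      using omega_pow_succ[of "0 :: 'a ordinal"] by (simp add: omega_pow_zero)
  qed
  have "1 < t"
    using one_less_omega assms by (rule less_le_trans)
  then have "d \<noteq> 0"
    using d by (metis less_asym omega_pow_zero)
  have "d \<noteq> 1"
    using d assms by (metis not_le om)
  have "d \<notin> LimOrd"
  proof
    assume L: "d \<in> LimOrd"
    have "omega_pow d \<le> t"
      unfolding omega_pow_LimOrd[OF L]
      using LimOrd_pos[OF L] d_least by (intro cSUP_least) auto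
    then show False using d by simp
  qed
  then obtain g where g: "d = g + 1"
    using \<open>d \<noteq> 0\<close> unfolding LimOrd_def by blast
  have "g \<noteq> 0"
    using g \<open>d \<noteq> 1\<close> by auto
  show ?thesis
  proof (rule ex1I[of _ "omega_pow g"])
    show "omega_pow g \<in> Class0 \<and> t \<in> {omega_pow g..<omega_pow g * \<omega>}"
    proof (intro conjI)
      have "0 < g"
        using \<open>g \<noteq> 0\<close> by (simp add: order_less_le)
      then show "omega_pow g \<in> Class0"
        unfolding Class0_def by blast
      show "t \<in> {omega_pow g..<omega_pow g * \<omega>}"
        using d d_least[of g] g by (simp add: omega_pow_succ)
    qed
    fix \<alpha> assume "\<alpha> \<in> Class0 \<and> t \<in> {\<alpha>..<\<alpha> * \<omega>}"
    then obtain c where c: "\<alpha> = omega_pow c" "omega_pow c \<le> t" "t < omega_pow (c + 1)"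
      by (auto simp: Class0_def omega_pow_succ)
    have "c + 1 \<le> g + 1 \<or> g + 1 \<le> c"
      by (metis linorder_le_less_linear ordinal_less_add_one_iff ordinal_add_one_le_iff)
    moreover have "\<not> g + 1 \<le> c"
      using omega_pow_mono[of "g + 1" c] c d g by auto
    moreover have "\<not> c + 1 \<le> g"
      using omega_pow_mono[of "c + 1" g] c d_least[of g] g by auto
    ultimately show "\<alpha> = omega_pow g"
      using c by (auto simp: ordinal_less_add_one_iff)
  qed
qed


section \<open>The relation \<open><\<^sub>1\<close>\<close>

definition iso_for :: "('a ordinal \<Rightarrow> 'a ordinal \<Rightarrow> bool) \<Rightarrow> ('a ordinal \<Rightarrow> 'a ordinal) \<Rightarrow>
    'a ordinal set \<Rightarrow> 'a ordinal set \<Rightarrow> bool" where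
  "iso_for R h Z Z' \<longleftrightarrow> bij_betw h Z Z' \<and>
    (\<forall>a\<in>Z. \<forall>b\<in>Z.
      (a < b \<longleftrightarrow> h a < h b) \<and>
      (R a b \<longleftrightarrow> R (h a) (h b)) \<and>
      (a + b \<in> Z \<longleftrightarrow> h a + h b \<in> Z') \<and>
      (a + b \<in> Z \<longrightarrow> h (a + b) = h a + h b))"

lemma iso_for_cong [fundef_cong]:
  assumes "Z = W" "Z' = W'" "h = k" "\<And>x y. x \<in> W \<union> W' \<Longrightarrow> y \<in> W \<union> W' \<Longrightarrow> R x y = S x y"
  shows "iso_for R h Z Z' = iso_for S k W W'"
proof -
  have "iso_for R h Z Z' = iso_for S h Z Z'"
    unfolding iso_for_def using assms(4) unfolding assms(1,2)[symmetric]
    by (intro conj_cong refl ball_cong) (auto simp: bij_betw_def)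
  then show ?thesis using assms by simp
qed

declare conj_cong [fundef_cong]

function less1 :: "'a ordinal \<Rightarrow> 'a ordinal \<Rightarrow> bool" (infix \<open><\<^sub>1\<close> 50) where
  "\<alpha> <\<^sub>1 \<beta> \<longleftrightarrow> \<alpha> < \<beta> \<and>
    (\<forall>Z. finite Z \<and> Z \<subseteq> {..<\<beta>} \<longrightarrow>
      (\<exists>Z' h. finite Z' \<and> Z' \<subseteq> {..<\<alpha>} \<and> iso_for (\<lambda>x y. x <\<^sub>1 y) h Z Z' \<and> (\<forall>x\<in>Z \<inter> {..<\<alpha>}. h x = x)))"
  by auto
termination
  by (relation "inv_image {(x, y). x < y} snd") (rule wf_inv_image[OF wf], auto intro: order_less_trans)

declare less1.simps [simp del]

abbreviation is_iso :: "('a ordinal \<Rightarrow> 'a ordinal) \<Rightarrow> 'a ordinal set \<Rightarrow> 'a ordinal set \<Rightarrow> bool" where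
  "is_iso \<equiv> iso_for less1"


section \<open>The maps \<open>g(0, \<alpha>, c)\<close>, the sets \<open>T(0, \<alpha>, t)\<close> and the relation \<open><\<^sup>0\<close>\<close>

text \<open>
  \<open>g_up \<alpha> c\<close> is \<open>g(0, \<alpha>, c)\<close> for \<open>\<alpha> \<le> c\<close>. Partial functions are represented by total ones; only the values on
  \<open>{..<\<alpha> * \<omega>}\<close> are meaningful, and the ones of \<open>g \<alpha> c\<close> with \<open>c < \<alpha>\<close> only on the image of \<open>g_up c \<alpha>\<close>.
\<close>

definition g_up :: "'a ordinal \<Rightarrow> 'a ordinal \<Rightarrow> 'a ordinal \<Rightarrow> 'a ordinal" where
  "g_up \<alpha> c x = (if x < \<alpha> then x
    else (THE y. \<exists>n l. 1 \<le> n \<and> n < \<omega> \<and> l < \<alpha> \<and> x = \<alpha> * n + l \<and> y = c * n + l))"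

definition g :: "'a ordinal \<Rightarrow> 'a ordinal \<Rightarrow> 'a ordinal \<Rightarrow> 'a ordinal" where
  "g \<alpha> c = (if \<alpha> \<le> c then g_up \<alpha> c else the_inv_into {..<c * \<omega>} (g_up c \<alpha>))"

definition T :: "'a ordinal \<Rightarrow> 'a ordinal \<Rightarrow> 'a ordinal set" where
  "T \<alpha> t = (if t < \<alpha> then {t}
    else {t} \<union> {left_diff (\<alpha> * n) t | n. 1 \<le> n \<and> n < \<omega> \<and> t \<in> {\<alpha> * n..<\<alpha> * n + \<alpha>}})"

definition less0 :: "'a ordinal \<Rightarrow> 'a ordinal \<Rightarrow> bool" (infix \<open><\<^sup>0\<close> 50) where
  "\<alpha> <\<^sup>0 t \<longleftrightarrow> \<alpha> \<in> Class0 \<and> t \<in> {\<alpha>..\<alpha> * \<omega>} \<and> \<alpha> < t \<and>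
    (\<forall>B. finite B \<and> B \<subseteq> {..<t} \<longrightarrow>
      (\<exists>\<delta>\<in>Class0 \<inter> {..<\<alpha>}.
        (\<Union>q\<in>B. T \<alpha> q) \<inter> {..<\<alpha>} \<subseteq> {..<\<delta>} \<and>
        is_iso (g \<alpha> \<delta>) B (g \<alpha> \<delta> ` B) \<and>
        (\<forall>x\<in>B \<inter> {..<\<alpha>}. g \<alpha> \<delta> x = x)))"

definition le0 :: "'a ordinal \<Rightarrow> 'a ordinal \<Rightarrow> bool" (infix \<open>\<le>\<^sup>0\<close> 50) where
  "\<alpha> \<le>\<^sup>0 t \<longleftrightarrow> \<alpha> <\<^sup>0 t \<or> \<alpha> = t"


section \<open>The classes \<open>A\<^sup>0(t)\<close> and \<open>G\<^sup>0(t)\<close>\<close>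

lemma the_pred_ordinal: "\<exists>l. t = l + 1 \<Longrightarrow> (THE l. t = l + 1) < (t :: 'a ordinal)"
  by (auto simp: ordinal_add_one_inject)

text \<open>
  Only the values at \<open>t \<ge> \<omega>\<close> are meaningful, for \<open>A0\<close> as well as for \<open>G0\<close>. For such \<open>t\<close>, the last case of \<open>A0\<close>
  is that of a limit ordinal \<open>t \<in> {\<alpha><..<\<alpha> * \<omega>}\<close>.
\<close>

function A0 :: "'a ordinal \<Rightarrow> 'a ordinal set" where
  "A0 t = (let \<alpha> = principal_part t in
    if t = \<alpha> then LimOf Class0 \<inter> {..<\<alpha> + 1}
    else if \<exists>l. t = l + 1 then LimOf (A0 (THE l. t = l + 1))
    else LimOf {r \<in> Class0 \<inter> {..<\<alpha> + 1}. T \<alpha> t \<inter> {..<\<alpha>} \<subseteq> {..<r} \<and>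
      (\<forall>s. s \<in> {\<alpha><..<t} \<and> T \<alpha> s \<inter> {..<\<alpha>} \<subseteq> {..<r} \<longrightarrow> r \<in> A0 s)})"
  by auto
termination
  by (relation "{(x, y). x < y}") (rule wf, simp_all only: mem_Collect_eq case_prod_conv the_pred_ordinal greaterThanLessThan_iff)

declare A0.simps [simp del]

definition G0 :: "'a ordinal \<Rightarrow> 'a ordinal set" where
  "G0 t = (let \<alpha> = principal_part t in
    {\<beta> \<in> Class0. T \<alpha> t \<inter> {..<\<alpha>} \<subseteq> {..<\<beta>} \<and> \<beta> \<le> \<alpha> \<and> \<beta> \<le>\<^sup>0 g \<alpha> \<beta> t + 1})"

end

theory Submission
  imports Defs
begin

text \<open>
  Write \<open>t = \<alpha> n + k\<close> with \<open>k < \<alpha>\<close> and \<open>n \<ge> 1\<close>. For \<open>\<beta> \<in> Class(0)\<close> with \<open>k < \<beta>\<close> and \<open>u = \<beta> n + k\<close>, the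
  following are equivalent: (a) \<open>\<beta> <\<^sup>0 u + 1\<close>; (b) \<open>\<beta> <\<^sub>1 u + 1\<close>; (c) \<open>\<beta>\<close> is a limit of \<open>r \<in> Class(0)\<close> with
  \<open>k < r\<close> and \<open>r \<le>\<^sub>1 r n + k\<close>. The step from (a) to (b) is immediate. For (b) to (c), apply (b) to
  \<open>Z = {\<xi>, k, 0, \<beta>, \<dots>, \<beta> n, u}\<close>: the isomorphism \<open>h\<close> sends \<open>u\<close> to \<open>h(\<beta>) n + k\<close>, and \<open>r = h(\<beta>)\<close> is additive principal,
  because \<open>r <\<^sub>1 h(u)\<close> holds only for additive principal \<open>r\<close> (for \<open>u = \<beta>\<close>, where this is not available, additive
  principal ordinals in between are found directly). For (c) to (a), show \<open>\<beta> <\<^sup>0 s\<close> for all \<open>s \<in> (\<beta>, u + 1]\<close> by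
  induction: for a finite \<open>B \<subset> s\<close> and a sufficiently large \<open>r\<close> as in (c), \<open>g(0, \<beta>, r)\<close> is an isomorphism on \<open>B\<close>.
  Given this, an induction on \<open>t\<close> turns the recursion for \<open>A\<^sup>0(t)\<close> into (c).
\<close>

section \<open>Ordinal arithmetic\<close>

lemma ordinal_plus_assoc: "a + b + c = a + (b + (c :: 'a ordinal))"
proof (induction c rule: less_induct)
  case (less c)
  show ?case
  proof (rule antisym)
    show "a + b + c \<le> a + (b + c)"
    proof (rule plus_ordinal_least)
      show "a + b \<le> a + (b + c)"
        by (metis le_plus_ordinal order_le_less plus_ordinal_strict_mono)
      show "a + b + d < a + (b + c)" if "d < c" for d
        using less that by (simp add: plus_ordinal_strict_mono)
    qed
    show "a + (b + c) \<le> a + b + c"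
    proof (rule plus_ordinal_least)
      show "a \<le> a + b + c"
        using le_plus_ordinal order_trans by blast
      show "a + x < a + b + c" if x: "x < b + c" for x
      proof (cases "x < b")
        case True
        then show ?thesis
          by (meson le_plus_ordinal order_less_le_trans plus_ordinal_strict_mono)
      next
        case False
        then obtain d where d: "x = b + d"
          by (metis not_le plus_left_diff)
        have "d < c"
          using x unfolding d by (metis linorder_less_linear order_less_asym plus_ordinal_strict_mono)
        then show ?thesis
          using less d plus_ordinal_strict_mono by metis
      qed
    qed
  qed
qed

lemma ordinal_plus_less_cancel: "a + b < a + c \<longleftrightarrow> b < (c :: 'a ordinal)"
  by (metis linorder_less_linear order_less_asym plus_ordinal_strict_mono)

lemma ordinal_pos_iff: "0 < x \<longleftrightarrow> x \<noteq> (0 :: 'a ordinal)"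
  by (metis ordinal_not_less_zero ordinal_zero_le order_le_less)

lemma one_times_ordinal: "1 * a = (a :: 'a ordinal)"
proof (induction a rule: less_induct)
  case (less a)
  show ?case
  proof (rule antisym)
    show "1 * a \<le> a"
      using less by (intro times_ordinal_least) simp
    show "a \<le> 1 * a"
      using less times_ordinal_add_le[of _ a 1] by (metis less_irrefl not_le ordinal_add_one_le_iff)
  qed
qed

section \<open>Multiples by natural numbers and division with remainder\<close>

primrec nmul :: "'a ordinal \<Rightarrow> nat \<Rightarrow> 'a ordinal" where
  "nmul a 0 = 0"
| "nmul a (Suc n) = nmul a n + a"

lemma nmul_add: "nmul a (m + n) = nmul a m + nmul a n"
  by (induction n) (simp_all add: ordinal_plus_assoc)

lemma nmul_Suc_left: "nmul a (Suc n) = a + nmul a n"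
  using nmul_add[of a 1 n] by simp

text \<open>Identifies \<open>nmul a n\<close> with the ordinal product by the finite ordinal
  \<open>nmul 1 n\<close>, so that induction on natural numbers can replace arguments about ordinals
  below \<open>\<omega>\<close>.\<close>

lemma times_nmul_one: "a * nmul 1 n = nmul a n"
  by (induction n) (simp_all add: times_ordinal_succ)

lemma nmul_one_less_omega: "nmul 1 n < (\<omega> :: 'a ordinal)"
  by (induction n) (simp_all add: LimOrd_pos LimOrd_add_one_less omega_in_LimOrd)

lemma less_omega_iff: "x < (\<omega> :: 'a ordinal) \<longleftrightarrow> (\<exists>n. x = nmul 1 n)"
proof
  show "x < \<omega> \<Longrightarrow> \<exists>n. x = nmul 1 n"
  proof (induction x rule: less_induct)
    case (less x)
    show ?case
    proof (cases "x = 0")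
      case True
      then show ?thesis by (metis nmul.simps(1))
    next
      case False
      have "x \<notin> LimOrd"
        using less.prems unfolding omega_def by (rule not_less_Least)
      then obtain k where k: "x = k + 1"
        using False by (auto simp: LimOrd_def)
      then have "k < x" by simp
      then obtain n where "k = nmul 1 n"
        using less by (meson order_less_trans)
      then have "x = nmul 1 (Suc n)"
        by (simp add: k)
      then show ?thesis ..
    qed
  qed
qed (auto simp: nmul_one_less_omega)

lemma nmul_add_le_times_omega: "nmul a n + a \<le> a * \<omega>"
  using times_ordinal_add_le[OF nmul_one_less_omega] by (metis times_nmul_one)

lemma less_times_omega_iff:
  assumes "0 < a"
  shows "x < a * \<omega> \<longleftrightarrow> (\<exists>n. x < nmul a n)"
proof
  assume "x < a * \<omega>"
  then have "\<not> (\<forall>d<\<omega>. a * d + a \<le> x)"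
    using times_ordinal_least by (metis not_le)
  then obtain d where d: "d < \<omega>" "x < a * d + a"
    by (auto simp: not_le)
  then obtain n where "d = nmul 1 n"
    by (auto simp: less_omega_iff)
  then have "x < nmul a (Suc n)"
    using d by (simp add: times_nmul_one)
  then show "\<exists>n. x < nmul a n" ..
next
  assume "\<exists>n. x < nmul a n"
  then show "x < a * \<omega>"
    by (metis nmul_add_le_times_omega le_plus_ordinal order_less_le_trans)
qed

lemma ex_nmul_add:
  assumes "x < a * \<omega>" "0 < a"
  shows "\<exists>n l. l < a \<and> x = nmul a n + l"
proof -
  have "x < nmul a m \<Longrightarrow> \<exists>n l. l < a \<and> x = nmul a n + l" for m
  proof (induction m)
    case (Suc m)
    show ?case
    proof (cases "x < nmul a m")
      case False
      then obtain l where l: "x = nmul a m + l"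
        by (metis not_le plus_left_diff)
      then have "l < a"
        using Suc.prems by (simp add: ordinal_plus_less_cancel)
      then show ?thesis using l by blast
    qed (use Suc in blast)
  qed simp
  then show ?thesis
    using assms less_times_omega_iff by blast
qed

lemma nmul_mono: "m \<le> n \<Longrightarrow> nmul a m \<le> nmul a n"
  by (metis le_add_diff_inverse le_plus_ordinal nmul_add)

lemma nmul_add_less:
  assumes "i < j" "l < a"
  shows "nmul a i + l < nmul a j + m"
proof -
  have "nmul a i + l < nmul a (Suc i)"
    using assms by (simp add: ordinal_plus_less_cancel)
  also have "\<dots> \<le> nmul a j"
    using assms by (intro nmul_mono) simp
  also have "\<dots> \<le> nmul a j + m"
    by (rule le_plus_ordinal)
  finally show ?thesis .
qed

text \<open>Quotient and remainder are compared lexicographically. The right-hand side does not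
  mention \<open>a\<close>, so the order survives a change of base that keeps the remainders below
  it.\<close>

lemma nmul_add_less_iff:
  assumes "l < a" "m < a"
  shows "nmul a i + l < nmul a j + m \<longleftrightarrow> i < j \<or> i = j \<and> l < m"
  using nmul_add_less[of i j l a m] nmul_add_less[of j i m a l] assms
  by (metis linorder_less_linear order_less_asym ordinal_plus_less_cancel)

lemma nmul_add_eq_iff:
  assumes "l < a" "m < a"
  shows "nmul a i + l = nmul a j + m \<longleftrightarrow> i = j \<and> l = m"
  using nmul_add_less_iff[OF assms] nmul_add_less_iff[OF assms(2,1)]
  by (metis linorder_less_linear order_less_irrefl)

lemma nmul_add_less_times_omega: "l < a \<Longrightarrow> nmul a n + l < a * \<omega>"
  by (meson nmul_add_le_times_omega order_less_le_trans plus_ordinal_strict_mono)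


section \<open>Additive principal ordinals\<close>

lemma omega_pow_strict_mono:
  assumes "b < c"
  shows "omega_pow b < omega_pow (c :: 'a ordinal)"
proof -
  have "0 < omega_pow b"
    by (meson one_le_omega_pow order_less_le_trans ordinal_zero_less_one)
  then have "omega_pow b < nmul (omega_pow b) (Suc 0) + omega_pow b"
    using plus_ordinal_strict_mono[of 0 "omega_pow b" "omega_pow b"] by simp
  also have "\<dots> \<le> omega_pow b * \<omega>"
    by (rule nmul_add_le_times_omega)
  also have "\<dots> \<le> omega_pow c"
    using assms by (rule omega_pow_times_le)
  finally show ?thesis .
qed

text \<open>A nonzero \<open>x\<close> meets the lower bound \<open>1\<close> in the minimality of
  \<open>omega_pow c\<close>, so it must miss one of the other bounds; for \<open>x = 0\<close> the
  exponent \<open>0\<close> serves.\<close>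

lemma less_omega_powE:
  assumes "x < omega_pow c" "0 < c"
  obtains d where "d < c" "x < omega_pow d * \<omega>"
proof (cases "x = 0")
  case True
  have "x < omega_pow 0 * \<omega>"
    by (simp add: True omega_pow_zero one_times_ordinal LimOrd_pos omega_in_LimOrd)
  then show ?thesis
    using assms that by blast
next
  case False
  then have "1 \<le> x"
    using ordinal_less_one_iff not_le by blast
  then show ?thesis
    using assms omega_pow_least that by (metis not_le)
qed

lemma times_omega_add_closed:
  assumes "x < a * \<omega>" "y < a * \<omega>" "0 < (a :: 'a ordinal)"
  shows "x + y < a * \<omega>"
proof -
  obtain m n where mn: "x < nmul a m" "y < nmul a n"
    using assms by (auto simp: less_times_omega_iff)
  have "x + y \<le> nmul a m + y"
    using mn by (intro plus_ordinal_mono_left) simp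
  also have "\<dots> < nmul a (m + n)"
    using mn by (simp add: nmul_add ordinal_plus_less_cancel)
  finally show ?thesis
    using assms less_times_omega_iff by blast
qed

text \<open>Both summands lie below \<open>omega_pow d * \<omega>\<close> for a common exponent, the
  larger of two, and such a product is closed under addition.\<close>

lemma Class0_add_less:
  assumes "c \<in> Class0" "x < c" "y < c"
  shows "x + y < c"
proof -
  obtain e where e: "c = omega_pow e" "0 < e"
    using assms by (auto simp: Class0_def)
  obtain d d' where d: "d < e" "x < omega_pow d * \<omega>" "d' < e" "y < omega_pow d' * \<omega>"
    using assms e by (metis less_omega_powE)
  have "omega_pow d * \<omega> \<le> omega_pow (max d d') * \<omega>" "omega_pow d' * \<omega> \<le> omega_pow (max d d') * \<omega>"
    by (auto intro!: times_ordinal_mono_left omega_pow_mono)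
  then have "x + y < omega_pow (max d d') * \<omega>"
    using d by (intro times_omega_add_closed)
      (auto intro: less_le_trans less_le_trans[OF _ one_le_omega_pow])
  also have "\<dots> \<le> omega_pow e"
    using d by (intro omega_pow_times_le) simp
  finally show ?thesis
    by (simp add: e)
qed

lemma Class0_absorb:
  assumes "c \<in> Class0" "x < c"
  shows "x + c = c"
proof (rule antisym)
  show "x + c \<le> c"
    using assms by (intro plus_ordinal_least) (auto intro: Class0_add_less)
qed (rule le_plus_ordinal_right)

lemma omega_le_Class0: "c \<in> Class0 \<Longrightarrow> \<omega> \<le> c"
  using omega_pow_times_le[of 0] by (auto simp: Class0_def omega_pow_zero one_times_ordinal)

lemma Class0_pos: "c \<in> Class0 \<Longrightarrow> 0 < (c :: 'a ordinal)"
  by (meson LimOrd_pos omega_in_LimOrd omega_le_Class0 order_less_le_trans)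

lemma Class0_one_less: "c \<in> Class0 \<Longrightarrow> 1 < (c :: 'a ordinal)"
  by (meson omega_le_Class0 one_less_omega order_less_le_trans)

lemma Class0_less_times_omega:
  assumes "c \<in> Class0"
  shows "c < c * \<omega>"
  using nmul_add_less_times_omega[of 0 c "Suc 0"] Class0_pos[OF assms] by simp

lemma Class0_unique:
  assumes "c \<in> Class0" "d \<in> Class0" "c \<le> d" "d < c * \<omega>"
  shows "d = c"
  using ex1_principal_part[of d] omega_le_Class0[OF assms(2)] assms Class0_less_times_omega[OF assms(2)]
  by (metis atLeastLessThan_iff order_refl)

lemma Class0_times_omega_le:
  assumes "c \<in> Class0" "d \<in> Class0" "c < d"
  shows "c * \<omega> \<le> d"
  using Class0_unique assms by (metis not_le less_imp_le less_irrefl)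

lemma principal_part_eq:
  assumes "a \<in> Class0" "a \<le> t" "t < a * \<omega>"
  shows "principal_part t = a"
  unfolding principal_part_def
  using ex1_principal_part[of t] omega_le_Class0[OF assms(1)] assms
  by (intro the1_equality) auto

lemma principal_partE:
  fixes t :: "'a ordinal"
  assumes "\<omega> \<le> t"
  obtains a n k where "a \<in> Class0" "1 \<le> n" "k < a" "t = nmul a n + k"
proof -
  obtain a where a: "a \<in> Class0" "a \<le> t" "t < a * \<omega>"
    using ex1_principal_part[OF assms] by auto
  then obtain n k where nk: "k < a" "t = nmul a n + k"
    using ex_nmul_add Class0_pos by blast
  then have "n \<noteq> 0"
    using a by (cases "n = 0") auto
  then show ?thesis
    using that[of a n k] a nk by simp
qed

text \<open>Below \<open>\<omega>\<close> a final \<open>1\<close> splits off; from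
  \<open>\<omega>\<close> on, the leading additive principal term splits off.\<close>

lemma not_Class0_decompose:
  assumes "x \<notin> Class0" "1 < (x :: 'a ordinal)"
  obtains y z where "y < x" "z < x" "x = y + z"
proof (cases "x < \<omega>")
  case True
  then obtain n where n: "x = nmul 1 n"
    by (auto simp: less_omega_iff)
  then obtain m where "n = Suc m"
    using assms by (cases n) auto
  then have "x = nmul 1 m + 1"
    using n by simp
  then show ?thesis
    using that[of "nmul 1 m" 1] assms by simp
next
  case False
  then obtain a n k where a: "a \<in> Class0" "1 \<le> n" "k < a" "x = nmul a n + k"
    using principal_partE by (metis not_le)
  then obtain m where m: "n = Suc m"
    by (cases n) auto
  have x: "x = a + (nmul a m + k)"
    using a(4) unfolding m nmul_Suc_left ordinal_plus_assoc .
  have "nmul a m + k < x"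
    using a m nmul_add_less by blast
  moreover have "a \<le> x"
    unfolding x by (rule le_plus_ordinal)
  then have "a < x"
    using a assms by (metis order_le_less)
  ultimately show ?thesis
    using that x by blast
qed

section \<open>Limit points of classes of ordinals\<close>

lemma LimOf_iff: "a \<in> LimOf A \<longleftrightarrow> a \<noteq> 0 \<and> (\<forall>x<a. \<exists>r\<in>A. x < r \<and> r < (a :: 'a ordinal))"
proof -
  have bdd: "bdd_above (A \<inter> {..<a})"
    by (auto intro: bdd_aboveI[of _ a])
  \<comment> \<open>With this default, \<open>a \<noteq> 0\<close> forces the set below
    \<open>a\<close> to be nonempty.\<close>
  have emp: "Sup {} = (0 :: 'a ordinal)"
    unfolding Sup_ordinal_def zero_ordinal_def by simp
  show ?thesis
  proof (intro iffI conjI allI impI)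
    assume a: "a \<in> LimOf A"
    then have eq: "Sup (A \<inter> {..<a}) = a" and nz: "a \<noteq> 0"
      by (auto simp: LimOf_def)
    show "a \<noteq> 0" by (rule nz)
    have ne: "A \<inter> {..<a} \<noteq> {}"
      using eq nz emp by auto
    fix x assume "x < a"
    then show "\<exists>r\<in>A. x < r \<and> r < a"
      using less_cSup_iff[OF ne bdd, of x] eq by auto
  next
    assume *: "a \<noteq> 0 \<and> (\<forall>x<a. \<exists>r\<in>A. x < r \<and> r < a)"
    then obtain r where "r \<in> A" "r < a"
      by (metis ordinal_pos_iff)
    then have ne: "A \<inter> {..<a} \<noteq> {}"
      by blast
    have "Sup (A \<inter> {..<a}) \<le> a"
      using ne by (intro cSup_least) auto
    moreover have "\<not> Sup (A \<inter> {..<a}) < a"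
      using * cSup_upper[OF _ bdd] by (metis Int_iff lessThan_iff not_le)
    ultimately show "a \<in> LimOf A"
      using * by (simp add: LimOf_def)
  qed
qed

text \<open>Otherwise some additive principal \<open>c < a\<close> satisfies
  \<open>a < c * \<omega>\<close>, and as a limit \<open>a\<close> would leave room for another
  additive principal ordinal in between.\<close>

lemma LimOf_Class0:
  assumes "a \<in> LimOf A" "A \<subseteq> Class0"
  shows "a \<in> Class0"
proof -
  note L = assms(1)[unfolded LimOf_iff]
  obtain r where "r \<in> A" "r < a"
    using L by (metis ordinal_pos_iff)
  then have "\<omega> \<le> a"
    using assms omega_le_Class0 by (metis less_imp_le order_trans subsetD)
  then obtain c where c: "c \<in> Class0" "c \<le> a" "a < c * \<omega>"
    using ex1_principal_part by (metis atLeastLessThan_iff)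
  have "\<not> c < a"
  proof
    assume "c < a"
    then obtain r where "r \<in> A" "c < r" "r < a"
      using L by blast
    then show False
      using Class0_unique[of c r] c assms by (metis less_imp_le less_irrefl order_less_trans subsetD)
  qed
  then show ?thesis
    using c by simp
qed

section \<open>Successors and leading terms of \<open>nmul a n + k\<close>\<close>

lemma Class0_succ_less: "c \<in> Class0 \<Longrightarrow> x < c \<Longrightarrow> x + 1 < c"
  by (meson Class0_add_less Class0_one_less)

lemma nmul_add_succ: "nmul a n + (k + 1) = nmul a n + k + (1 :: 'a ordinal)"
  by (simp add: ordinal_plus_assoc)

lemma nmul_add_eq_succE:
  assumes "a \<in> Class0" "k < a" "nmul a n + k = x + 1"
  obtains m where "k = m + 1" "x = nmul a n + m"
proof -
  have "x < nmul a n + k"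
    using assms by simp
  also have "\<dots> < a * \<omega>"
    by (rule nmul_add_less_times_omega) fact
  finally obtain i m where im: "m < a" "x = nmul a i + m"
    using ex_nmul_add Class0_pos assms by blast
  then have "nmul a n + k = nmul a i + (m + 1)" "m + 1 < a"
    using assms Class0_succ_less by (simp_all add: nmul_add_succ)
  then have "n = i" "k = m + 1"
    using assms nmul_add_eq_iff by blast+
  then show ?thesis
    using that im by blast
qed

lemma principal_part_nmul_add:
  assumes "a \<in> Class0" "k < a" "1 \<le> n"
  shows "a \<le> nmul a n + k" "principal_part (nmul a n + k) = a"
    "a < nmul a n + k \<longleftrightarrow> (n, k) \<noteq> (Suc 0, 0)"
proof -
  show *: "a \<le> nmul a n + k"
    using nmul_mono[OF assms(3), of a] le_plus_ordinal[of "nmul a n" k] by simp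
  then show "principal_part (nmul a n + k) = a"
    using assms by (intro principal_part_eq nmul_add_less_times_omega)
  have "nmul a n + k = a \<longleftrightarrow> n = Suc 0 \<and> k = 0"
    using nmul_add_eq_iff[of k a 0 n "Suc 0"] assms Class0_pos[OF assms(1)] by simp
  then show "a < nmul a n + k \<longleftrightarrow> (n, k) \<noteq> (Suc 0, 0)"
    using * by (auto simp: order_less_le)
qed


section \<open>The maps \<open>g\<close> and the sets \<open>T\<close> in terms of remainders\<close>

lemma g_up_nmul_add:
  assumes "l < a"
  shows "g_up a c (nmul a n + l) = nmul c n + l"
proof (cases n)
  case 0
  then show ?thesis
    using assms by (simp add: g_up_def)
next
  case (Suc m)
  have "a \<le> nmul a (Suc m) + l"
    unfolding nmul_Suc_left ordinal_plus_assoc by (rule le_plus_ordinal)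
  then have nl: "\<not> nmul a n + l < a"
    by (simp add: Suc not_less)
  have one: "1 \<le> nmul (1 :: 'a ordinal) (Suc m)"
    by (simp only: nmul_Suc_left le_plus_ordinal)
  have "(THE y. \<exists>n' l'. 1 \<le> n' \<and> n' < \<omega> \<and> l' < a \<and> nmul a n + l = a * n' + l' \<and> y = c * n' + l')
    = nmul c n + l"
  proof (rule the_equality)
    show "\<exists>n' l'. 1 \<le> n' \<and> n' < \<omega> \<and> l' < a \<and> nmul a n + l = a * n' + l' \<and> nmul c n + l = c * n' + l'"
      using one assms Suc by (intro exI[of _ "nmul 1 n"] exI[of _ l])
        (simp only: times_nmul_one nmul_one_less_omega simp_thms)
  next
    fix y assume "\<exists>n' l'. 1 \<le> n' \<and> n' < \<omega> \<and> l' < a \<and> nmul a n + l = a * n' + l' \<and> y = c * n' + l'"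
    then obtain i l' where "l' < a" "nmul a n + l = nmul a i + l'" "y = nmul c i + l'"
      by (auto simp: less_omega_iff times_nmul_one)
    then show "y = nmul c n + l"
      using assms nmul_add_eq_iff by metis
  qed
  then show ?thesis
    using nl by (simp add: g_up_def)
qed

lemma inj_on_g_up:
  assumes "0 < a" "a \<le> c"
  shows "inj_on (g_up a c) {..<a * \<omega>}"
proof (rule inj_onI)
  fix x y assume "x \<in> {..<a * \<omega>}" "y \<in> {..<a * \<omega>}" and eq: "g_up a c x = g_up a c y"
  then obtain i l j m where *: "l < a" "x = nmul a i + l" "m < a" "y = nmul a j + m"
    using ex_nmul_add assms by (metis lessThan_iff)
  then have "nmul c i + l = nmul c j + m"
    using eq by (simp add: g_up_nmul_add)
  then have "i = j \<and> l = m"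
    using * assms nmul_add_eq_iff by (meson less_le_trans)
  then show "x = y"
    using * by simp
qed

text \<open>One formula for both directions: for \<open>c < a\<close> the map \<open>g a c\<close>
  inverts \<open>g_up c a\<close>, which sends \<open>nmul c n + l\<close> to
  \<open>nmul a n + l\<close> because \<open>l < c\<close>.\<close>

lemma g_nmul_add:
  assumes "l < a" "l < c"
  shows "g a c (nmul a n + l) = nmul c n + l"
proof (cases "a \<le> c")
  case True
  then show ?thesis
    using assms by (simp add: g_def g_up_nmul_add)
next
  case False
  have "0 < c"
    using assms by (meson order_le_less_trans ordinal_zero_le)
  then have "the_inv_into {..<c * \<omega>} (g_up c a) (nmul a n + l) = nmul c n + l"
    using False assms
    by (intro the_inv_into_f_eq inj_on_g_up) (auto simp: g_up_nmul_add nmul_add_less_times_omega)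
  then show ?thesis
    using False by (simp add: g_def)
qed

lemma g_fix: "x < a \<Longrightarrow> x < c \<Longrightarrow> g a c x = x"
  using g_nmul_add[of x a c 0] by simp

text \<open>For \<open>n > 0\<close> the point itself is at least \<open>a\<close>, and the interval
  condition fixes the multiplier, so only the remainder is left below \<open>a\<close>.\<close>

lemma T_nmul_add:
  assumes "l < a"
  shows "T a (nmul a n + l) \<inter> {..<a} = {l}"
proof (cases n)
  case 0
  then show ?thesis
    using assms by (simp add: T_def)
next
  case (Suc m)
  have "a \<le> nmul a (Suc m) + l"
    unfolding nmul_Suc_left ordinal_plus_assoc by (rule le_plus_ordinal)
  then have nl: "\<not> nmul a n + l < a"
    by (simp add: Suc not_less)
  have one: "1 \<le> nmul (1 :: 'a ordinal) (Suc m)"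
    by (simp only: nmul_Suc_left le_plus_ordinal)
  have ld: "left_diff (nmul a n) (nmul a n + l) = l"
    by (metis le_plus_ordinal plus_left_diff plus_ordinal_left_cancel)
  have "{left_diff (a * n') (nmul a n + l) | n'. 1 \<le> n' \<and> n' < \<omega> \<and> nmul a n + l \<in> {a * n'..<a * n' + a}} = {l}"
    (is "?S = _")
  proof (intro equalityI subsetI)
    fix y assume "y \<in> ?S"
    then obtain i where i: "y = left_diff (nmul a i) (nmul a n + l)"
      "nmul a i \<le> nmul a n + l" "nmul a n + l < nmul a i + a"
      by (auto simp: less_omega_iff times_nmul_one)
    then have s: "nmul a i + y = nmul a n + l"
      by (simp add: plus_left_diff)
    then have "y < a"
      using i by (metis ordinal_plus_less_cancel)
    then show "y \<in> {l}"
      using s assms nmul_add_eq_iff by blast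
  next
    fix y assume "y \<in> {l}"
    then have "y = left_diff (a * nmul 1 n) (nmul a n + l)"
      by (simp add: times_nmul_one ld)
    moreover have "1 \<le> nmul (1 :: 'a ordinal) n" "nmul 1 n < (\<omega> :: 'a ordinal)"
      "nmul a n + l \<in> {a * nmul 1 n..<a * nmul 1 n + a}"
      using one assms Suc
      by (simp_all only: times_nmul_one nmul_one_less_omega atLeastLessThan_iff le_plus_ordinal
          ordinal_plus_less_cancel simp_thms)
    ultimately show "y \<in> ?S"
      by blast
  qed
  then show ?thesis
    using nl assms by (auto simp: T_def)
qed


section \<open>The relation \<open><\<^sub>1\<close>\<close>

lemma is_isoD:
  assumes "is_iso h Z Z'" "x \<in> Z"
  shows is_iso_in: "h x \<in> Z'"
    and is_iso_less_iff: "y \<in> Z \<Longrightarrow> x < y \<longleftrightarrow> h x < h y"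
    and is_iso_less1_iff: "y \<in> Z \<Longrightarrow> x <\<^sub>1 y \<longleftrightarrow> h x <\<^sub>1 h y"
    and is_iso_plus: "y \<in> Z \<Longrightarrow> x + y \<in> Z \<Longrightarrow> h (x + y) = h x + h y"
proof -
  show "h x \<in> Z'"
    using assms bij_betwE unfolding iso_for_def by metis
  assume "y \<in> Z"
  note * = assms(1)[unfolded iso_for_def, THEN conjunct2, rule_format, OF assms(2) this]
  show "x < y \<longleftrightarrow> h x < h y" "x <\<^sub>1 y \<longleftrightarrow> h x <\<^sub>1 h y"
    "x + y \<in> Z \<Longrightarrow> h (x + y) = h x + h y"
    using * by simp_all
qed

lemma less1_imp_less: "a <\<^sub>1 b \<Longrightarrow> a < b"
  by (subst (asm) less1.simps) blast

lemma less1E: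
  assumes "a <\<^sub>1 b" "finite Z" "Z \<subseteq> {..<b}"
  obtains Z' h where "finite Z'" "Z' \<subseteq> {..<a}" "is_iso h Z Z'" "\<And>x. x \<in> Z \<Longrightarrow> x < a \<Longrightarrow> h x = x"
  using assms by (subst (asm) less1.simps) (metis IntI lessThan_iff)

lemma less1I:
  assumes "a < b"
    and "\<And>Z. finite Z \<Longrightarrow> Z \<subseteq> {..<b} \<Longrightarrow> \<exists>Z' h. Z' \<subseteq> {..<a} \<and> is_iso h Z Z' \<and> (\<forall>x\<in>Z. x < a \<longrightarrow> h x = x)"
  shows "a <\<^sub>1 b"
proof (subst less1.simps, intro conjI allI impI)
  fix Z assume Z: "finite Z \<and> Z \<subseteq> {..<b}"
  then obtain Z' h where *: "Z' \<subseteq> {..<a}" "is_iso h Z Z'" "\<forall>x\<in>Z. x < a \<longrightarrow> h x = x"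
    using assms(2)[of Z] by metis
  then have "finite Z'"
    using Z bij_betw_finite unfolding iso_for_def by metis
  then show "\<exists>Z' h. finite Z' \<and> Z' \<subseteq> {..<a} \<and> is_iso h Z Z' \<and> (\<forall>x\<in>Z \<inter> {..<a}. h x = x)"
    using * by blast
qed fact

lemma less1_mono:
  assumes "a <\<^sub>1 b" "a < c" "c \<le> b"
  shows "a <\<^sub>1 c"
proof (rule less1I)
  fix Z assume "finite Z" "Z \<subseteq> {..<c}"
  then have "finite Z" "Z \<subseteq> {..<b}"
    using assms by (auto intro: less_le_trans)
  then show "\<exists>Z' h. Z' \<subseteq> {..<a} \<and> is_iso h Z Z' \<and> (\<forall>x\<in>Z. x < a \<longrightarrow> h x = x)"
    using less1E[OF assms(1)] by metis
qed fact

text \<open>The isomorphisms compose: \<open>Z\<close> is first moved below \<open>b\<close>, then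
  below \<open>a\<close>, and points below \<open>a\<close> are fixed both times.\<close>

lemma less1_trans:
  assumes "a <\<^sub>1 b" "b <\<^sub>1 c"
  shows "a <\<^sub>1 c"
proof (rule less1I)
  show "a < c"
    using assms less1_imp_less order_less_trans by blast
  fix Z assume "finite Z" "Z \<subseteq> {..<c}"
  then obtain Z' h where h: "finite Z'" "Z' \<subseteq> {..<b}" "is_iso h Z Z'" "\<And>x. x \<in> Z \<Longrightarrow> x < b \<Longrightarrow> h x = x"
    using less1E[OF assms(2)] by metis
  then obtain Z'' k where k: "finite Z''" "Z'' \<subseteq> {..<a}" "is_iso k Z' Z''" "\<And>x. x \<in> Z' \<Longrightarrow> x < a \<Longrightarrow> k x = x"
    using less1E[OF assms(1)] by metis
  have hin: "h x \<in> Z'" if "x \<in> Z" for x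
    using h(3) that by (rule is_iso_in)
  have "is_iso (k \<circ> h) Z Z''"
    unfolding iso_for_def
  proof (intro conjI ballI)
    show "bij_betw (k \<circ> h) Z Z''"
      using h k unfolding iso_for_def by (blast intro: bij_betw_trans)
    fix x y assume xy: "x \<in> Z" "y \<in> Z"
    note H = h(3)[unfolded iso_for_def, THEN conjunct2, rule_format, OF xy]
    note K = k(3)[unfolded iso_for_def, THEN conjunct2, rule_format, OF hin[OF xy(1)] hin[OF xy(2)]]
    show "(x < y) = ((k \<circ> h) x < (k \<circ> h) y)" "(x <\<^sub>1 y) = ((k \<circ> h) x <\<^sub>1 (k \<circ> h) y)"
      "(x + y \<in> Z) = ((k \<circ> h) x + (k \<circ> h) y \<in> Z'')"
      "x + y \<in> Z \<longrightarrow> (k \<circ> h) (x + y) = (k \<circ> h) x + (k \<circ> h) y"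
      using H K by simp_all
  qed
  moreover have "(k \<circ> h) x = x" if "x \<in> Z" "x < a" for x
    using that h(4) k(4) hin less1_imp_less[OF assms(1)] by (metis comp_apply order_less_trans)
  ultimately show "\<exists>Z' h. Z' \<subseteq> {..<a} \<and> is_iso h Z Z' \<and> (\<forall>x\<in>Z. x < a \<longrightarrow> h x = x)"
    using k(2) by blast
qed

text \<open>A decomposition \<open>a = y + z\<close> with \<open>y, z < a\<close> would be fixed by every isomorphism of \<open>{y, z, a}\<close> that
  fixes \<open>y\<close> and \<open>z\<close>, so that \<open>a\<close> could not be moved below \<open>a\<close>.\<close>

lemma less1_Class0:
  assumes "a <\<^sub>1 b"
  shows "a \<in> Class0"
proof (rule ccontr)
  assume nC: "a \<notin> Class0"
  have ab: "a < b"
    using assms by (rule less1_imp_less)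
  have "1 < a"
  proof (rule ccontr)
    assume "\<not> 1 < a"
    \<comment> \<open>For \<open>a = 0\<close> there is no room for the image of \<open>0\<close>;
      for \<open>a = 1\<close> both \<open>0\<close> and \<open>1\<close> would have to go to
      \<open>0\<close>.\<close>
    then have a: "a = 0 \<or> a = 1"
      by (metis ordinal_less_one_iff linorder_less_linear)
    have "{0, a} \<subseteq> {..<b}"
      using ab by (metis empty_subsetI insert_subset lessThan_iff order_le_less_trans ordinal_zero_le)
    then obtain Z' h where h: "Z' \<subseteq> {..<a}" "is_iso h {0, a} Z'"
      using less1E[OF assms, of "{0, a}"] by (metis finite.emptyI finite.insertI)
    then have "h 0 < a" "h a < a"
      using is_iso_in[OF h(2)] by blast+
    moreover have "h 0 < h a" if "0 < a"
      using is_iso_less_iff[OF h(2), of 0 a] that by simp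
    ultimately show False
      using a by auto
  qed
  then obtain y z where yz: "y < a" "z < a" "a = y + z"
    using nC not_Class0_decompose by metis
  then have "{y, z, a} \<subseteq> {..<b}"
    using ab by (auto intro: order_less_trans)
  then obtain Z' h where h: "Z' \<subseteq> {..<a}" "is_iso h {y, z, a} Z'"
    "\<And>x. x \<in> {y, z, a} \<Longrightarrow> x < a \<Longrightarrow> h x = x"
    using less1E[OF assms, of "{y, z, a}"] by (metis finite.emptyI finite.insertI)
  have "h (y + z) = h y + h z"
    using is_iso_plus[OF h(2), of y z] yz by simp
  moreover have "h y = y" "h z = z"
    using h(3) yz(1,2) by blast+
  ultimately have "h a = a"
    using yz(3) by simp
  moreover have "h a < a"
    using h(1) is_iso_in[OF h(2), of a] by blast
  ultimately show False
    by simp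
qed

text \<open>The failure is witnessed by one finite \<open>Z\<close>, bounded strictly below
  \<open>b\<close>, and the same \<open>Z\<close> refutes the relation at every \<open>c\<close>
  above that bound.\<close>

lemma less1_left_limit:
  assumes "a < b" "\<not> a <\<^sub>1 b"
  obtains x where "x < b" "\<And>c. x < c \<Longrightarrow> \<not> a <\<^sub>1 c"
proof -
  obtain Z where Z: "finite Z" "Z \<subseteq> {..<b}"
    "\<not> (\<exists>Z' h. Z' \<subseteq> {..<a} \<and> is_iso h Z Z' \<and> (\<forall>x\<in>Z. x < a \<longrightarrow> h x = x))"
    using less1I assms by metis
  show ?thesis
  proof (rule that[of "Max (insert a Z)"])
    show "Max (insert a Z) < b"
      using Z assms by auto
    fix c assume c: "Max (insert a Z) < c"
    then have "Z \<subseteq> {..<c}"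
      using Z by auto
    then show "\<not> a <\<^sub>1 c"
      using Z less1E[OF _ Z(1)] by metis
  qed
qed

lemma finite_common_bound:
  fixes b :: "'b :: linorder"
  assumes "finite S" "x0 < b" "\<And>s. s \<in> S \<Longrightarrow> \<exists>x<b. \<forall>c>x. P s c"
  shows "\<exists>x<b. \<forall>s\<in>S. \<forall>c>x. P s c"
  using assms(1,3)
proof (induction S rule: finite_induct)
  case empty
  then show ?case using assms(2) by blast
next
  case (insert s S)
  obtain x where x: "x < b" "\<forall>s\<in>S. \<forall>c>x. P s c"
    using insert by blast
  obtain y where y: "y < b" "\<forall>c>y. P s c"
    using insert by blast
  show ?case
    using x y by (intro exI[of _ "max x y"]) auto
qed


section \<open>Isomorphisms induced by \<open>g\<close>\<close>

text \<open>For \<open>j > 0\<close> the remainder \<open>l\<close> is absorbed by the first copy of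
  \<open>c\<close> in the second summand.\<close>

lemma nmul_add_plus_nmul_add:
  assumes "c \<in> Class0" "l < c"
  shows "(nmul c i + l) + (nmul c j + m) = (if j = 0 then nmul c i + (l + m) else nmul c (i + j) + m)"
proof (cases j)
  case 0
  then show ?thesis
    by (simp add: ordinal_plus_assoc)
next
  case (Suc j')
  have "(nmul c i + l) + (nmul c j + m) = nmul c i + ((l + c) + (nmul c j' + m))"
    using Suc nmul_Suc_left[of c j'] by (simp add: ordinal_plus_assoc)
  also have "\<dots> = nmul c i + (nmul c (Suc j') + m)"
    using assms by (simp only: Class0_absorb nmul_Suc_left ordinal_plus_assoc)
  also have "\<dots> = nmul c (i + j) + m"
    by (simp only: Suc nmul_add ordinal_plus_assoc)
  finally show ?thesis
    by (simp add: Suc)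
qed

text \<open>Order and sums follow the same rules on quotients and remainders over \<open>b\<close>
  and over \<open>c\<close>. For \<open><\<^sub>1\<close>, \<open>up\<close> settles
  \<open>b\<close> as left argument, \<open>low\<close> and \<open>up\<close> settle points below
  \<open>b\<close>, and points of \<open>B\<close> above \<open>b\<close> are never left
  arguments.\<close>

lemma is_iso_g:
  assumes b: "b \<in> Class0" and c: "c \<in> Class0" "c < b"
    and B: "\<And>x. x \<in> B \<Longrightarrow> \<exists>i l. l < c \<and> x = nmul b i + l"
    and up: "\<And>x. x \<in> B \<Longrightarrow> b < x \<Longrightarrow> b <\<^sub>1 x \<and> c <\<^sub>1 g b c x"
    and low: "\<And>x. x \<in> B \<Longrightarrow> x < b \<Longrightarrow> x <\<^sub>1 b \<longleftrightarrow> x <\<^sub>1 c"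
  shows "is_iso (g b c) B (g b c ` B)"
proof -
  have geq: "g b c (nmul b i + l) = nmul c i + l" if "l < c" for i l
    using that c by (intro g_nmul_add) auto
  have less: "x < y \<longleftrightarrow> g b c x < g b c y" if xy: "x \<in> B" "y \<in> B" for x y
  proof -
    obtain i l j m where "l < c" "x = nmul b i + l" "m < c" "y = nmul b j + m"
      using B xy by metis
    then show ?thesis
      using c nmul_add_less_iff[of l b m i j] nmul_add_less_iff[of l c m i j] by (simp add: geq)
  qed
  have inj: "inj_on (g b c) B"
    by (rule inj_onI) (metis less linorder_less_linear less_irrefl)
  have plus: "(x + y \<in> B \<longleftrightarrow> g b c x + g b c y \<in> g b c ` B) \<and>
      (x + y \<in> B \<longrightarrow> g b c (x + y) = g b c x + g b c y)" if xy: "x \<in> B" "y \<in> B" for x y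
  proof -
    obtain i l j m where r: "l < c" "x = nmul b i + l" "m < c" "y = nmul b j + m"
      using B xy by metis
    have lm: "l + m < c" "l < b"
      using r c Class0_add_less by auto
    have gxy: "g b c x = nmul c i + l" "g b c y = nmul c j + m"
      using r geq by simp_all
    define p where "p = (if j = 0 then i else i + j)"
    define q where "q = (if j = 0 then l + m else m)"
    have pq: "q < c" "x + y = nmul b p + q" "g b c x + g b c y = nmul c p + q"
      unfolding gxy unfolding r(2,4) nmul_add_plus_nmul_add[OF b lm(2)] nmul_add_plus_nmul_add[OF c(1) r(1)] p_def q_def
      using lm r by simp_all
    have "x + y \<in> B" if img: "g b c x + g b c y \<in> g b c ` B"
    proof -
      obtain z where z: "z \<in> B" "g b c z = nmul c p + q"
        using img pq(3) by auto
      then obtain k n where "n < c" "z = nmul b k + n"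
        using B by metis
      then have "k = p" "n = q"
        using z pq nmul_add_eq_iff[of n c q k p] by (simp_all add: geq)
      then show ?thesis
        using z \<open>z = nmul b k + n\<close> pq by simp
    qed
    moreover have "g b c (x + y) = g b c x + g b c y"
      unfolding pq(3) unfolding pq(2) using pq(1) by (rule geq)
    ultimately show ?thesis
      by (metis imageI)
  qed
  have gb: "g b c b = c"
    using g_nmul_add[of 0 b c "Suc 0"] Class0_pos[OF b] Class0_pos[OF c(1)] by simp
  have fixed: "g b c x = x" "x < c" if "x \<in> B" "x < b" for x
  proof -
    obtain i l where r: "l < c" "x = nmul b i + l"
      using B \<open>x \<in> B\<close> by metis
    then have "i = 0"
      using that(2) nmul_add_less_iff[of l b 0 i "Suc 0"] c Class0_pos[OF b] by auto
    then show "g b c x = x" "x < c"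
      using r c by (simp_all add: g_fix)
  qed
  have ge: "c \<le> g b c x \<and> g b c x < c * \<omega> \<and> (g b c x = c \<longrightarrow> x = b)" if x: "x \<in> B" "b \<le> x" for x
  proof -
    obtain i l where r: "l < c" "x = nmul b i + l"
      using B x by metis
    then have "i \<noteq> 0"
      using x c by (cases "i = 0") auto
    then have "c \<le> nmul c i + l"
      using r c principal_part_nmul_add(1)[of c l i] by simp
    moreover have "x = b" if "nmul c i + l = c"
      using that r nmul_add_eq_iff[of l c 0 i "Suc 0"] Class0_pos[OF c(1)] by simp
    ultimately show ?thesis
      using r by (simp add: geq nmul_add_less_times_omega)
  qed
  have rel: "x <\<^sub>1 y \<longleftrightarrow> g b c x <\<^sub>1 g b c y" if xy: "x \<in> B" "y \<in> B" for x y
  proof (cases "x < y")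
    case False
    then show ?thesis
      using less[OF xy] less1_imp_less by blast
  next
    case xly: True
    show ?thesis
    proof (cases "y < b")
      case True
      then show ?thesis
        using xly xy by (simp add: fixed)
    next
      case yb: False
      show ?thesis
      proof (cases "x < b")
        case True
        \<comment> \<open>Monotonicity leads from \<open>z\<close> down to \<open>d\<close>,
          transitivity from \<open>d\<close> up to \<open>z\<close>. This replaces \<open>y\<close>
          by \<open>b\<close> and its image by \<open>c\<close>.\<close>
        have absorb: "x <\<^sub>1 z \<longleftrightarrow> x <\<^sub>1 d" if "d = z \<or> d <\<^sub>1 z" "x < d" for d z
          using that by (metis less1_imp_less less1_mono less1_trans less_imp_le)
        have "b = y \<or> b <\<^sub>1 y" "c = g b c y \<or> c <\<^sub>1 g b c y"
          using yb up[OF xy(2)] gb by (metis not_less order_le_less)+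
        then have "x <\<^sub>1 y \<longleftrightarrow> x <\<^sub>1 b" "x <\<^sub>1 g b c y \<longleftrightarrow> x <\<^sub>1 c"
          using absorb True fixed(2)[OF xy(1) True] by blast+
        then show ?thesis
          using True low xy by (simp add: fixed)
      next
        case False
        show ?thesis
        proof (cases "x = b")
          case True
          then show ?thesis
            using up[OF xy(2)] xly gb by simp
        next
          case xb: False
          \<comment> \<open>Both \<open>x\<close> and its image lie strictly between an additive
            principal ordinal and its product with \<open>\<omega>\<close>; hence they are not
            additive principal, and both sides of the equivalence are false.\<close>
          obtain i l where "l < c" "x = nmul b i + l"
            using B xy by metis
          then have "x < b * \<omega>"
            using c nmul_add_less_times_omega by (meson order_less_trans)
          then have "x \<notin> Class0"
            using xb False Class0_unique b by (metis not_less)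
          moreover have "g b c x \<notin> Class0"
            using xb False ge[OF xy(1)] Class0_unique c by (metis not_less)
          ultimately show ?thesis
            using less1_Class0 by blast
        qed
      qed
    qed
  qed
  show ?thesis
    unfolding iso_for_def using inj less rel plus by (auto simp: bij_betw_def)
qed


section \<open>The step from \<open>t\<close> to \<open>t + 1\<close>\<close>

text \<open>With \<open>b = omega_pow e\<close> and \<open>x < omega_pow d * \<omega>\<close>, the
  power with exponent \<open>d + 1\<close> serves if \<open>d + 1 < e\<close>. The case
  \<open>e = d + 1\<close> is contradictory: the equation \<open>omega_pow d + b = b\<close> would
  be copied to a point below \<open>b\<close>, where adding \<open>omega_pow d\<close> on the left
  raises the quotient by one.\<close>

lemma less1_succ_imp_Lim_Class0:
  assumes b: "b \<in> Class0" and "b <\<^sub>1 b + 1"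
  shows "b \<in> LimOf Class0"
  unfolding LimOf_iff
proof (intro conjI allI impI)
  show "b \<noteq> 0"
    using Class0_pos[OF b] by simp
  fix x assume xb: "x < b"
  obtain e where e: "b = omega_pow e" "0 < e"
    using b by (auto simp: Class0_def)
  obtain d where d: "d < e" "x < omega_pow d * \<omega>"
    using xb e less_omega_powE by metis
  show "\<exists>r\<in>Class0. x < r \<and> r < b"
  proof (cases "d + 1 < e")
    case True
    have "0 < d + 1"
      by (meson ordinal_less_add_one order_le_less_trans ordinal_zero_le)
    then have "omega_pow (d + 1) \<in> Class0"
      by (auto simp: Class0_def)
    then show ?thesis
      using True d e omega_pow_strict_mono omega_pow_succ by metis
  next
    case False
    then have "e = d + 1"
      using d by (metis antisym_conv2 ordinal_add_one_le_iff)
    then have bd: "b = omega_pow d * \<omega>"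
      using e by (simp add: omega_pow_succ)
    have db: "omega_pow d < b"
      using d e omega_pow_strict_mono by blast
    then have "{omega_pow d, b} \<subseteq> {..<b + 1}"
      by (auto simp: ordinal_less_add_one_iff)
    then obtain Z' h where h: "Z' \<subseteq> {..<b}" "is_iso h {omega_pow d, b} Z'"
      "\<And>x. x \<in> {omega_pow d, b} \<Longrightarrow> x < b \<Longrightarrow> h x = x"
      using less1E[OF assms(2), of "{omega_pow d, b}"] by (metis finite.emptyI finite.insertI)
    have "h (omega_pow d + b) = h (omega_pow d) + h b"
      using is_iso_plus[OF h(2), of "omega_pow d" b] Class0_absorb[OF b db] by simp
    moreover have "h (omega_pow d) = omega_pow d"
      using h(3) db by blast
    ultimately have hb: "h b = omega_pow d + h b"
      by (simp only: Class0_absorb[OF b db])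
    have p: "0 < omega_pow d"
      by (meson one_le_omega_pow order_less_le_trans ordinal_zero_less_one)
    have "h b < b"
      using h(1) is_iso_in[OF h(2), of b] by blast
    then have "h b < omega_pow d * \<omega>"
      by (simp only: bd)
    then obtain n l where n: "l < omega_pow d" "h b = nmul (omega_pow d) n + l"
      using ex_nmul_add p by blast
    then have "nmul (omega_pow d) n + l = nmul (omega_pow d) (Suc n) + l"
      using hb by (simp only: nmul_Suc_left ordinal_plus_assoc)
    then show ?thesis
      using nmul_add_eq_iff[OF n(1) n(1)] n_not_Suc_n by metis
  qed
qed

text \<open>For \<open>t = \<alpha> * n + k\<close>, the elements \<open>\<le> \<alpha>\<close> turn out to be the set whose limits form \<open>A\<^sup>0(t)\<close>, in all
  three cases of its definition; the disjunct \<open>r = nmul r n + k\<close> covers \<open>t = \<alpha>\<close>.\<close>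

definition reflecting :: "nat \<Rightarrow> 'a ordinal \<Rightarrow> 'a ordinal set" where
  "reflecting n k = {r \<in> Class0. k < r \<and> (r = nmul r n + k \<or> r <\<^sub>1 nmul r n + k)}"

lemma less1_imp_LimOf_reflecting:
  assumes b: "b \<in> Class0" and k: "k < b" and n: "1 \<le> n"
    and less1: "b <\<^sub>1 nmul b n + k + 1"
  shows "b \<in> LimOf (reflecting n k)"
proof (cases "(n, k) = (Suc 0, 0)")
  case True
  then have "b <\<^sub>1 b + 1"
    using less1 by simp
  then have "b \<in> LimOf Class0"
    using b less1_succ_imp_Lim_Class0 by blast
  moreover have "reflecting n k = Class0"
    using True Class0_pos by (auto simp: reflecting_def)
  ultimately show ?thesis
    by simp
next
  case False
  define u where "u = nmul b n + k"
  have bu: "b < u"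
    using principal_part_nmul_add(3)[OF b k n] False unfolding u_def by simp
  have b1: "b <\<^sub>1 u"
    using less1 bu unfolding u_def[symmetric] by (rule less1_mono) (simp add: less_imp_le)
  show ?thesis
    unfolding LimOf_iff
  proof (intro conjI allI impI)
    show "b \<noteq> 0"
      using Class0_pos[OF b] by simp
    fix x assume xb: "x < b"
    \<comment> \<open>The points \<open>x\<close> and \<open>k\<close> force \<open>x < h b\<close>
      and \<open>k < h b\<close>. The multiples of \<open>b\<close> from \<open>0\<close> on make
      \<open>h\<close> commute with multiplication by numbers up to \<open>n\<close>, so that
      \<open>h b\<close> determines \<open>h u\<close>.\<close>
    define Z where "Z = {x, k, u} \<union> nmul b ` {..n}"
    have "nmul b i \<le> u" if "i \<le> n" for i
      using nmul_mono[OF that, of b] le_plus_ordinal order_trans unfolding u_def by blast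
    then have "Z \<subseteq> {..<u + 1}"
      using xb k bu by (auto simp: Z_def ordinal_less_add_one_iff)
    moreover have "finite Z"
      by (simp add: Z_def)
    ultimately obtain Z' h where h: "Z' \<subseteq> {..<b}" "is_iso h Z Z'" "\<And>x. x \<in> Z \<Longrightarrow> x < b \<Longrightarrow> h x = x"
      using less1E[OF less1[folded u_def]] by metis
    have nZ: "nmul b i \<in> Z" if "i \<le> n" for i
      using that by (simp add: Z_def)
    have bZ: "b \<in> Z"
      using nZ[OF n] by simp
    note plus = is_iso_plus[OF h(2)] and less_iff = is_iso_less_iff[OF h(2)]
    have mul: "i \<le> n \<Longrightarrow> h (nmul b i) = nmul (h b) i" for i
    proof (induction i)
      case 0
      then show ?case
        using h(3)[of 0] nZ[of 0] Class0_pos[OF b] by simp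
    next
      case (Suc i)
      then show ?case
        using plus[of "nmul b i" b] nZ[of i] nZ[of "Suc i"] bZ by simp
    qed
    have "h u = nmul (h b) n + k"
      using plus[of "nmul b n" k] mul[of n] nZ[of n] h(3)[of k] k by (simp add: u_def Z_def)
    then have "h b <\<^sub>1 nmul (h b) n + k"
      using is_iso_less1_iff[OF h(2) bZ, of u] b1 by (simp add: Z_def)
    moreover have "x < h b" "k < h b"
      using less_iff[OF _ bZ, of x] less_iff[OF _ bZ, of k] h(3)[of x] h(3)[of k] xb k by (simp_all add: Z_def)
    moreover have "h b < b"
      using h(1) is_iso_in[OF h(2) bZ] by blast
    \<comment> \<open>\<open>h b\<close> is additive principal because it is a left argument of
      \<open><\<^sub>1\<close>, as transported from \<open>b <\<^sub>1 u\<close>.\<close>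
    ultimately show "\<exists>r\<in>reflecting n k. x < r \<and> r < b"
      using less1_Class0 by (intro bexI[of _ "h b"]) (auto simp: reflecting_def)
  qed
qed

text \<open>A point \<open>c\<close> of \<open>reflecting n k\<close> close enough to
  \<open>b\<close> satisfies the hypotheses of \<open>is_iso_g\<close> on \<open>B\<close>. The
  second assumption on \<open>s\<close> is what an induction on \<open>s\<close> provides.\<close>

lemma LimOf_reflecting_ex_iso:
  assumes b: "b \<in> Class0" and k: "k < b" and n: "1 \<le> n"
    and lim: "b \<in> LimOf (reflecting n k)"
    and s: "s \<le> nmul b n + k + 1" "\<And>y. b < y \<Longrightarrow> y < s \<Longrightarrow> b <\<^sub>1 y"
    and B: "finite B" "B \<subseteq> {..<s}"
  shows "\<exists>c\<in>Class0 \<inter> {..<b}. (\<forall>x\<in>B. \<exists>i l. l < c \<and> x = nmul b i + l) \<and> is_iso (g b c) B (g b c ` B)"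
proof -
  have Bu: "y \<le> nmul b n + k" if "y \<in> B" for y
    using that B s(1) by (metis lessThan_iff less_le_trans ordinal_less_add_one_iff subsetD)
  have "nmul b n + k < b * \<omega>"
    using k by (rule nmul_add_less_times_omega)
  then have ex: "\<exists>i l. l < b \<and> y = nmul b i + l" if "y \<in> B" for y
    using that Bu ex_nmul_add Class0_pos[OF b] by (meson order_le_less_trans)
  \<comment> \<open>The threshold for \<open>y\<close> is at least its remainder and, if
    \<open>y < b\<close> but not \<open>y <\<^sub>1 b\<close>, also a bound beyond which
    \<open>y <\<^sub>1 c\<close> fails.\<close>
  have "\<exists>x<b. \<forall>y\<in>B. \<forall>c>x. (\<exists>i l. l < c \<and> y = nmul b i + l) \<and> (y < b \<and> y <\<^sub>1 c \<longrightarrow> y <\<^sub>1 b)"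
  proof (rule finite_common_bound[OF B(1) Class0_pos[OF b]])
    fix y assume "y \<in> B"
    then obtain i l where l: "l < b" "y = nmul b i + l"
      using ex by blast
    show "\<exists>x<b. \<forall>c>x. (\<exists>i l. l < c \<and> y = nmul b i + l) \<and> (y < b \<and> y <\<^sub>1 c \<longrightarrow> y <\<^sub>1 b)"
    proof (cases "y < b \<and> \<not> y <\<^sub>1 b")
      case True
      then obtain x where "x < b" "\<And>c. x < c \<Longrightarrow> \<not> y <\<^sub>1 c"
        using less1_left_limit by blast
      then show ?thesis
        using l by (intro exI[of _ "max x l"]) auto
    next
      case False
      then show ?thesis
        using l by (intro exI[of _ l]) auto
    qed
  qed
  then obtain x where x: "x < b"
    "\<And>y c. y \<in> B \<Longrightarrow> x < c \<Longrightarrow> (\<exists>i l. l < c \<and> y = nmul b i + l) \<and> (y < b \<and> y <\<^sub>1 c \<longrightarrow> y <\<^sub>1 b)"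
    by blast
  obtain c where c: "c \<in> reflecting n k" "x < c" "c < b"
    using lim x(1) unfolding LimOf_iff by blast
  have cC: "c \<in> Class0" "k < c" "c = nmul c n + k \<or> c <\<^sub>1 nmul c n + k"
    using c by (auto simp: reflecting_def)
  have rep: "\<exists>i l. l < c \<and> y = nmul b i + l" if "y \<in> B" for y
    using x(2)[OF that c(2)] by blast
  have "is_iso (g b c) B (g b c ` B)"
  proof (rule is_iso_g[OF b cC(1) c(3) rep])
    fix y assume y: "y \<in> B"
    obtain i l where il: "l < c" "y = nmul b i + l"
      using rep[OF y] by blast
    have lb: "l < b"
      using il c by auto
    have gy: "g b c y = nmul c i + l"
      using il c by (simp add: g_nmul_add)
    show "b <\<^sub>1 y \<and> c <\<^sub>1 g b c y" if "b < y"
    proof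
      show "b <\<^sub>1 y"
        using s(2) that y B by blast
      have "i \<noteq> 0 \<and> (i, l) \<noteq> (Suc 0, 0)"
        using that il lb by (cases "i = 0") auto
      then have less: "c < nmul c i + l"
        using principal_part_nmul_add(3)[OF cC(1) il(1), of i] by simp
      \<comment> \<open>The comparison depends only on the pairs \<open>(n, k)\<close> and
        \<open>(i, l)\<close>, so it carries over to \<open>c\<close>, and monotonicity applies to
        \<open>c <\<^sub>1 nmul c n + k\<close>.\<close>
      have "\<not> nmul b n + k < nmul b i + l"
        using Bu[OF y] il by simp
      then have "\<not> nmul c n + k < nmul c i + l"
        using nmul_add_less_iff[OF k lb, of n i] nmul_add_less_iff[OF cC(2) il(1), of n i] by simp
      then show "c <\<^sub>1 g b c y"
        using cC(3) less less1_mono unfolding gy by (metis not_less)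
    qed
    show "y <\<^sub>1 b \<longleftrightarrow> y <\<^sub>1 c" if "y < b"
    proof
      show "y <\<^sub>1 b" if "y <\<^sub>1 c"
        using x(2)[OF y c(2)] that \<open>y < b\<close> by blast
      have "i = 0"
        using that il lb nmul_add_less_iff[of l b 0 i "Suc 0"] Class0_pos[OF b] by auto
      then have "y < c"
        using il by simp
      then show "y <\<^sub>1 c" if "y <\<^sub>1 b"
        using that c less1_mono by (meson less_imp_le)
    qed
  qed
  then show ?thesis
    using cC c rep by blast
qed

text \<open>The map \<open>g b c\<close> is itself the required isomorphism: the condition on
  \<open>T\<close> bounds all remainders by \<open>c\<close>, so the image lies below
  \<open>c * \<omega> \<le> b\<close>.\<close>

lemma less0_imp_less1:
  assumes "b <\<^sup>0 t"
  shows "b <\<^sub>1 t"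
proof (rule less1I)
  have b: "b \<in> Class0" and t: "t \<le> b * \<omega>" "b < t"
    and ex: "\<And>B. finite B \<Longrightarrow> B \<subseteq> {..<t} \<Longrightarrow> \<exists>c\<in>Class0 \<inter> {..<b}.
        (\<Union>q\<in>B. T b q) \<inter> {..<b} \<subseteq> {..<c} \<and> is_iso (g b c) B (g b c ` B) \<and>
        (\<forall>x\<in>B \<inter> {..<b}. g b c x = x)"
    using assms unfolding less0_def atLeastAtMost_iff by blast+
  show "b < t" by fact
  fix B assume B: "finite B" "B \<subseteq> {..<t}"
  then obtain c where c: "c \<in> Class0" "c < b" "(\<Union>q\<in>B. T b q) \<inter> {..<b} \<subseteq> {..<c}"
    "is_iso (g b c) B (g b c ` B)" "\<forall>x\<in>B \<inter> {..<b}. g b c x = x"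
    using ex by blast
  have "g b c x < b" if "x \<in> B" for x
  proof -
    have "x < b * \<omega>"
      using that B t by (meson lessThan_iff less_le_trans subsetD)
    then obtain i l where il: "l < b" "x = nmul b i + l"
      using ex_nmul_add Class0_pos[OF b] by blast
    then have "l \<in> (\<Union>q\<in>B. T b q) \<inter> {..<b}"
      using T_nmul_add[of l b i] that by blast
    then have "l < c"
      using c by blast
    then have "g b c x < c * \<omega>"
      using c il by (simp add: g_nmul_add nmul_add_less_times_omega)
    then show ?thesis
      using Class0_times_omega_le[OF c(1) b c(2)] by simp
  qed
  then show "\<exists>Z' h. Z' \<subseteq> {..<b} \<and> is_iso h B Z' \<and> (\<forall>x\<in>B. x < b \<longrightarrow> h x = x)"
    using c by (intro exI[of _ "g b c ` B"] exI[of _ "g b c"]) auto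
qed

text \<open>Induction on \<open>s\<close>: the hypothesis, weakened to \<open><\<^sub>1\<close>,
  gives \<open>b <\<^sub>1 y\<close> for all \<open>y\<close> strictly between \<open>b\<close> and
  \<open>s\<close>, as the isomorphisms on finite subsets of \<open>s\<close> demand.\<close>

lemma LimOf_reflecting_imp_less0:
  assumes b: "b \<in> Class0" and k: "k < b" and n: "1 \<le> n"
    and lim: "b \<in> LimOf (reflecting n k)"
    and "b < s" "s \<le> nmul b n + k + 1"
  shows "b <\<^sup>0 s"
  using assms(5,6)
proof (induction s rule: less_induct)
  case (less s)
  have IH: "b <\<^sub>1 y" if "b < y" "y < s" for y
    using less.IH[OF that(2,1)] that(2) less.prems(2) by (meson less0_imp_less1 less_imp_le order_trans)
  have s: "s \<le> b * \<omega>"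
    using nmul_add_less_times_omega[OF k, of n] less.prems(2)
    by (meson order_trans ordinal_add_one_le_iff)
  have "\<exists>c\<in>Class0 \<inter> {..<b}. (\<Union>q\<in>B. T b q) \<inter> {..<b} \<subseteq> {..<c} \<and>
      is_iso (g b c) B (g b c ` B) \<and> (\<forall>x\<in>B \<inter> {..<b}. g b c x = x)"
    if B: "finite B" "B \<subseteq> {..<s}" for B
  proof -
    obtain c where c: "c \<in> Class0 \<inter> {..<b}" "\<forall>x\<in>B. \<exists>i l. l < c \<and> x = nmul b i + l"
      "is_iso (g b c) B (g b c ` B)"
      using LimOf_reflecting_ex_iso[OF b k n lim less.prems(2) IH B] by blast
    have cb: "c < b"
      using c(1) by simp
    have T: "T b x \<inter> {..<b} \<subseteq> {..<c}" and fixed: "x < b \<Longrightarrow> g b c x = x" if xB: "x \<in> B" for x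
    proof -
      obtain i l where il: "l < c" "x = nmul b i + l"
        using c(2) xB by blast
      have lb: "l < b"
        using il(1) cb by (rule order_less_trans)
      show "T b x \<inter> {..<b} \<subseteq> {..<c}"
        unfolding il(2) T_nmul_add[OF lb] using il(1) by simp
      assume "x < b"
      then have "i = 0"
        using nmul_add_less_iff[OF lb Class0_pos[OF b], of i "Suc 0"] il(2) by simp
      then have "x = l"
        using il(2) by simp
      then show "g b c x = x"
        using il(1) lb by (simp add: g_fix)
    qed
    have "(\<Union>q\<in>B. T b q) \<inter> {..<b} \<subseteq> {..<c}"
      using T by blast
    moreover have "\<forall>x\<in>B \<inter> {..<b}. g b c x = x"
      using fixed by simp
    ultimately show ?thesis
      using c by blast
  qed
  then show ?case
    using b s less.prems(1) by (simp add: less0_def)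
qed

lemma less1_succ_iff_LimOf_reflecting:
  assumes "b \<in> Class0" "k < b" "1 \<le> n"
  shows "b <\<^sub>1 nmul b n + k + 1 \<longleftrightarrow> b \<in> LimOf (reflecting n k)" (is "?R \<longleftrightarrow> ?L")
    and "b <\<^sup>0 nmul b n + k + 1 \<longleftrightarrow> b \<in> LimOf (reflecting n k)"
proof -
  have "b < nmul b n + k + 1"
    using principal_part_nmul_add(1)[OF assms] by (simp add: ordinal_less_add_one_iff)
  then have "b <\<^sup>0 nmul b n + k + 1" if ?L
    using LimOf_reflecting_imp_less0[OF assms that] by blast
  moreover have ?L if ?R
    using assms that by (rule less1_imp_LimOf_reflecting)
  ultimately show "?R \<longleftrightarrow> ?L" "b <\<^sup>0 nmul b n + k + 1 \<longleftrightarrow> ?L"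
    using less0_imp_less1 by blast+
qed

section \<open>The classes \<open>A\<^sup>0(t)\<close> and \<open>G\<^sup>0(t)\<close>\<close>

text \<open>Equality in \<open>\<le>\<^sup>0\<close> is excluded by
  \<open>b < nmul b n + k + 1\<close>, and at this successor \<open><\<^sup>0\<close> agrees with
  \<open><\<^sub>1\<close>.\<close>

lemma G0_nmul_add:
  assumes a: "a \<in> Class0" and k: "k < a" and n: "1 \<le> n"
  shows "G0 (nmul a n + k) = {b \<in> Class0. k < b \<and> b \<le> a \<and> b <\<^sub>1 nmul b n + k + 1}"
proof -
  have "b \<le>\<^sup>0 g a b (nmul a n + k) + 1 \<longleftrightarrow> b <\<^sub>1 nmul b n + k + 1"
    if b: "b \<in> Class0" "k < b" for b
  proof -
    have "b \<noteq> nmul b n + k + 1"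
      using principal_part_nmul_add(1)[OF b n] by (metis not_le ordinal_less_add_one)
    then show ?thesis
      using less1_succ_iff_LimOf_reflecting[OF b n] b k by (simp add: g_nmul_add le0_def)
  qed
  then show ?thesis
    unfolding G0_def Let_def principal_part_nmul_add(2)[OF a k n] T_nmul_add[OF k] by auto
qed

lemma LimOf_inter_atMost:
  fixes a :: "'a ordinal"
  shows "LimOf (A \<inter> {..a}) = LimOf A \<inter> {..a}"
proof (intro equalityI subsetI)
  fix x assume x: "x \<in> LimOf (A \<inter> {..a})"
  have "x \<le> a"
  proof (rule ccontr)
    assume "\<not> x \<le> a"
    then have "a < x"
      by simp
    then obtain r where "r \<in> A \<inter> {..a}" "a < r"
      using x unfolding LimOf_iff by blast
    then show False
      by (metis Int_iff atMost_iff not_le)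
  qed
  then show "x \<in> LimOf A \<inter> {..a}"
    using x by (auto simp: LimOf_iff)
next
  fix x assume "x \<in> LimOf A \<inter> {..a}"
  then show "x \<in> LimOf (A \<inter> {..a})"
    by (simp add: LimOf_iff) (metis IntI atMost_iff less_imp_le order_trans)
qed

text \<open>A limit of \<open>reflecting n k\<close> lies above one of its elements, hence above
  \<open>k\<close>; the equivalence for successors does the rest.\<close>

lemma LimOf_reflecting_inter_atMost:
  assumes "1 \<le> n"
  shows "LimOf (reflecting n k) \<inter> {..a} = {b \<in> Class0. k < b \<and> b \<le> a \<and> b <\<^sub>1 nmul b n + k + 1}"
proof -
  have "b \<in> Class0 \<and> k < b" if b: "b \<in> LimOf (reflecting n k)" for b
  proof
    show "b \<in> Class0"
      using b by (rule LimOf_Class0) (auto simp: reflecting_def)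
    obtain r where "r \<in> reflecting n k" "r < b"
      using b unfolding LimOf_iff by (metis ordinal_pos_iff)
    then show "k < b"
      by (auto simp: reflecting_def)
  qed
  then show ?thesis
    using less1_succ_iff_LimOf_reflecting(1) assms by blast
qed

text \<open>Strong induction on the ordinal: each of the three clauses of \<open>A0\<close> reduces
  to \<open>LimOf (reflecting n k \<inter> {..a})\<close>.\<close>

lemma A0_nmul_add:
  assumes a: "a \<in> Class0" and "k < a" "1 \<le> n"
  shows "A0 (nmul a n + k) = {b \<in> Class0. k < b \<and> b \<le> a \<and> b <\<^sub>1 nmul b n + k + 1}"
  using assms(2,3)
proof (induction "nmul a n + k" arbitrary: n k rule: less_induct)
  case less
  define t where "t = nmul a n + k"
  note k = less.prems(1) and n = less.prems(2)
  note pp = principal_part_nmul_add[OF a k n, folded t_def]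
  have "A0 t = LimOf (reflecting n k \<inter> {..a})"
  proof (cases "t = a")
    case True
    then have "n = Suc 0" "k = 0"
      using pp(3) by auto
    then have "reflecting n k = Class0"
      using Class0_pos by (auto simp: reflecting_def)
    moreover have "{..<a + 1} = {..a}"
      by (auto simp: ordinal_less_add_one_iff)
    ultimately show ?thesis
      using pp(2) True by (subst A0.simps) (simp add: Let_def LimOf_inter_atMost)
  next
    case ta: False
    then have nk: "(n, k) \<noteq> (Suc 0, 0)"
      using pp(1,3) by (metis order_le_less)
    \<comment> \<open>Outside the case \<open>t = a\<close>, the strict inequality
      \<open>r < nmul r n + k\<close> rules out the equality disjunct.\<close>
    have refl: "r \<in> reflecting n k \<longleftrightarrow> r \<in> Class0 \<and> k < r \<and> r <\<^sub>1 nmul r n + k" for r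
      using principal_part_nmul_add(3)[OF _ _ n, of r k] nk unfolding reflecting_def
      by (metis (mono_tags, lifting) less_irrefl mem_Collect_eq)
    show ?thesis
    proof (cases "\<exists>l. t = l + 1")
      case True
      then obtain l where l: "t = l + 1"
        by blast
      then obtain m where m: "k = m + 1" "l = nmul a n + m"
        using nmul_add_eq_succE[OF a k] unfolding t_def by metis
      have the: "(THE l. t = l + 1) = l"
        using l by (auto simp: ordinal_add_one_inject)
      have "m < a"
        using m k by (metis ordinal_less_add_one order_less_trans)
      then have "A0 l = {b \<in> Class0. m < b \<and> b \<le> a \<and> b <\<^sub>1 nmul b n + m + 1}"
        unfolding m(2) using l m n by (intro less.hyps) (auto simp: t_def)
      \<comment> \<open>Since \<open>k = m + 1\<close>, the two reflection conditions coincide;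
        \<open>m < b\<close> gives \<open>k < b\<close> because additive principal ordinals are
        closed under successor.\<close>
      also have "\<dots> = reflecting n k \<inter> {..a}"
        using refl m(1) Class0_succ_less by (auto simp: nmul_add_succ intro: order_less_trans[OF ordinal_less_add_one])
      finally show ?thesis
        using True ta pp(2) the by (subst A0.simps) (simp add: Let_def)
    next
      case lim: False
      have "{r \<in> Class0 \<inter> {..<a + 1}. T a t \<inter> {..<a} \<subseteq> {..<r} \<and>
          (\<forall>s. s \<in> {a<..<t} \<and> T a s \<inter> {..<a} \<subseteq> {..<r} \<longrightarrow> r \<in> A0 s)} = reflecting n k \<inter> {..a}"
      proof -
        \<comment> \<open>Replacing \<open>a\<close> by \<open>r\<close> matches the
          \<open>s\<close> in question with the points strictly between \<open>r\<close> and
          \<open>nmul r n + k\<close>. The induction hypothesis turns \<open>r \<in> A0 s\<close>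
          into \<open><\<^sub>1\<close> at the successor of the matching point.\<close>
        have "(\<forall>s. s \<in> {a<..<t} \<and> T a s \<inter> {..<a} \<subseteq> {..<r} \<longrightarrow> r \<in> A0 s) \<longleftrightarrow> r <\<^sub>1 nmul r n + k"
          (is "?L \<longleftrightarrow> _") if r: "r \<in> Class0" "r \<le> a" "k < r" for r
        proof
          have rt: "r < nmul r n + k"
            using principal_part_nmul_add(3)[OF r(1,3) n] nk by simp
          have A0s: "r \<in> A0 (nmul a i + l) \<longleftrightarrow> r <\<^sub>1 nmul r i + l + 1"
            if "nmul a i + l < t" "1 \<le> i" "l < r" for i l
            using less.hyps[of i l] that r by (auto simp: t_def)
          {
            assume L: ?L
            \<comment> \<open>Were \<open>nmul r n + k\<close> a successor, then so would be
              \<open>k\<close>, and hence \<open>t\<close>.\<close>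
            have succ: "x + 1 < nmul r n + k" if x: "x < nmul r n + k" for x
            proof -
              have "x + 1 \<noteq> nmul r n + k"
              proof
                assume "x + 1 = nmul r n + k"
                then obtain m where "k = m + 1"
                  using nmul_add_eq_succE[OF r(1,3)] by metis
                then show False
                  using lim by (auto simp: t_def nmul_add_succ)
              qed
              then show ?thesis
                using x by (metis order_le_less ordinal_add_one_le_iff)
            qed
            have less1: "r <\<^sub>1 x + 1" if x: "r < x" "x < nmul r n + k" for x
            proof -
              have "x < r * \<omega>"
                using x nmul_add_less_times_omega[OF r(3)] by (meson order_less_trans)
              then obtain i l where il: "l < r" "x = nmul r i + l"
                using ex_nmul_add Class0_pos[OF r(1)] by blast
              then have i: "1 \<le> i"
                using x by (cases i) auto
              have la: "l < a"
                using il r by simp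
              have "a < nmul a i + l"
                using x il principal_part_nmul_add(3)[OF r(1) il(1) i]
                  principal_part_nmul_add(3)[OF a la i] by simp
              moreover have lt: "nmul a i + l < t"
                using x il nmul_add_less_iff[OF il(1) r(3), of i n] nmul_add_less_iff[OF la k, of i n]
                by (simp add: t_def)
              ultimately have "r \<in> A0 (nmul a i + l)"
                using L T_nmul_add[OF la, of i] il by simp
              then show ?thesis
                using A0s[OF lt i il(1)] il by simp
            qed
            show "r <\<^sub>1 nmul r n + k"
            proof (rule less1I[OF rt])
              fix Z assume Z: "finite Z" "Z \<subseteq> {..<nmul r n + k}"
              \<comment> \<open>Inserting \<open>r + 1\<close> ensures \<open>r < x\<close>, also
                for empty \<open>Z\<close>; then \<open>Z\<close> lies below \<open>x + 1\<close>,
                where reflection is already known.\<close>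
              define x where "x = Max (insert (r + 1) Z)"
              have "x < nmul r n + k"
                using Z succ[OF rt] by (auto simp: x_def)
              moreover have "r + 1 \<le> x"
                using Z unfolding x_def by (intro Max_ge) auto
              then have "r < x"
                by simp
              ultimately have "r <\<^sub>1 x + 1"
                using less1 by blast
              moreover have "Z \<subseteq> {..<x + 1}"
                using Z by (auto simp: x_def ordinal_less_add_one_iff)
              ultimately show "\<exists>Z' h. Z' \<subseteq> {..<r} \<and> is_iso h Z Z' \<and> (\<forall>x\<in>Z. x < r \<longrightarrow> h x = x)"
                using less1E[OF _ Z(1)] by metis
            qed
          }
          {
            assume R: "r <\<^sub>1 nmul r n + k"
            show ?L
            proof (intro allI impI)
              fix s assume s: "s \<in> {a<..<t} \<and> T a s \<inter> {..<a} \<subseteq> {..<r}"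
              then have "s < a * \<omega>"
                using nmul_add_less_times_omega[OF k, of n] by (auto simp: t_def)
              then obtain i l where il: "l < a" "s = nmul a i + l"
                using ex_nmul_add Class0_pos[OF a] by blast
              then have lr: "l < r"
                using s T_nmul_add[of l a i] by simp
              have i: "1 \<le> i"
                using s il by (cases i) auto
              have lt: "nmul a i + l < t"
                using s il by simp
              then have "nmul r i + l < nmul r n + k"
                using nmul_add_less_iff[OF lr r(3), of i n] nmul_add_less_iff[OF il(1) k, of i n]
                by (simp add: t_def)
              moreover have "r < nmul r i + l + 1"
                using principal_part_nmul_add(1)[OF r(1) lr i] by (simp add: ordinal_less_add_one_iff)
              ultimately have "r <\<^sub>1 nmul r i + l + 1"
                using less1_mono[OF R] by simp
              then show "r \<in> A0 s"
                using A0s[OF lt i lr] il by simp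
            qed
          }
        qed
        then show ?thesis
          using refl T_nmul_add[OF k, of n] by (auto simp: t_def ordinal_less_add_one_iff)
      qed
      then show ?thesis
        using lim ta pp(2) by (subst A0.simps) (simp add: Let_def)
    qed
  qed
  then show ?case
    using LimOf_reflecting_inter_atMost[OF n] by (simp add: t_def LimOf_inter_atMost)
qed

theorem theorem1:
  fixes t :: "'a ordinal"
  assumes "\<omega> \<le> t"
  shows "G0 t = A0 t"
proof -
  obtain a n k where a: "a \<in> Class0" "1 \<le> n" "k < a" and t: "t = nmul a n + k"
    using assms by (rule principal_partE)
  show ?thesis
    unfolding t G0_nmul_add[OF a(1,3,2)] A0_nmul_add[OF a(1,3,2)] ..
qed

end
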